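(* Let $F : \mathbb{N} \rightarrow \mathbb{N}$ be a nondecreasing function such that: (a) there exist $c,\epsilon > 0$ such that for all $n \in \mathbb{N}$, $$F(n) \geq \exp\big( c\, n (\log n)^2 (\log\log n)^{1+\epsilon} \big);$$ (b) there exist $C_1, C_2 > 1$ such that for all $n \in \mathbb{N}$, $$F(n)^{C_1} \leq F(C_2 n).$$ Then there exist a residually finite group $G$, generated by a finite set $S$, and constants $C_1', C_2' > 0$ such that for all $n \in \mathbb{N}$, $$F(C_1' n) \leq \mathcal{F}_G^S(n) \leq F(C_2' n).$$
   Context: $\mathbb{N}=\{1,2,3,\dots\}$ and $\log$ is the natural logarithm. For a function $F:\mathbb{N}\to\mathbb{N}$ and a real $x\in(0,\infty)$ that is not an integer, $F(x)$ means $F(\lceil x\rceil)$. The factor $(\log\log n)^{1+\epsilon}$ is read as $0$ for $n\in\{1,2\}$. A group $G$ is residually finite if for every nontrivial $g\in G$ there is a finite-index subgroup of $G$ not containing $g$. For $G$ generated by a finite set $S$, let $B_S(n)=\{s_1\cdots s_m : 0\le m\le n,\ s_i\in S\cup S^{-1}\}$. The normal depth of a nontrivial $g\in G$ is the minimal index of a finite-index normal subgroup of $G$ not containing $g$. The residual finiteness growth function $\mathcal{F}_G^S:\mathbb{N}\to\mathbb{N}$ is defined by letting $\mathcal{F}_G^S(n)$ be the maximal normal depth among the nontrivial elements of $B_S(n)$. *)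

theory Defs
  imports Complex_Main "HOL-Algebra.Generated_Groups"
begin

text \<open>
  Functions on the positive integers are rendered as functions on \<^typ>\<open>nat\<close> that are only ever
  constrained and evaluated at arguments \<open>\<ge> 1\<close>.
\<close>

text \<open>The value \<open>F(x) = F(\<lceil>x\<rceil>)\<close> for a real \<open>x > 0\<close>; it agrees with \<open>F x\<close> when \<open>x\<close> is an integer.\<close>

definition at_real :: "(nat \<Rightarrow> nat) \<Rightarrow> real \<Rightarrow> nat" where
  "at_real F x = F (nat \<lceil>x\<rceil>)"

text \<open>
  The factor \<open>(log log n)^(1 + \<epsilon>)\<close>. For \<open>n \<le> 2\<close> the double logarithm is undefined or negative, and
  the factor is 0 by convention; for \<open>n \<ge> 3\<close> the base is positive.
\<close>

definition loglog_power :: "real \<Rightarrow> nat \<Rightarrow> real" where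
  "loglog_power \<epsilon> n = (if n \<le> 2 then 0 else ln (ln (real n)) powr (1 + \<epsilon>))"

definition finite_index :: "('a, 'b) monoid_scheme \<Rightarrow> 'a set \<Rightarrow> bool" where
  "finite_index G H \<longleftrightarrow> finite (rcosets\<^bsub>G\<^esub> H)"

definition residually_finite :: "('a, 'b) monoid_scheme \<Rightarrow> bool" where
  "residually_finite G \<longleftrightarrow>
     (\<forall>g \<in> carrier G - {\<one>\<^bsub>G\<^esub>}. \<exists>H. subgroup H G \<and> finite_index G H \<and> g \<notin> H)"

definition word_ball :: "('a, 'b) monoid_scheme \<Rightarrow> 'a set \<Rightarrow> nat \<Rightarrow> 'a set" where
  "word_ball G S n =
     {foldr (\<otimes>\<^bsub>G\<^esub>) ss \<one>\<^bsub>G\<^esub> | ss. length ss \<le> n \<and> set ss \<subseteq> S \<union> (\<lambda>s. inv\<^bsub>G\<^esub> s) ` S}"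

text \<open>
  Meaningful for nontrivial elements of a residually finite group, where the minimum ranges over a
  nonempty set (pass to the normal core of a finite-index subgroup).
\<close>

definition normal_depth :: "('a, 'b) monoid_scheme \<Rightarrow> 'a \<Rightarrow> nat" where
  "normal_depth G g =
     (LEAST k. \<exists>N. N \<lhd> G \<and> finite_index G N \<and> g \<notin> N \<and> k = card (rcosets\<^bsub>G\<^esub> N))"

text \<open>
  For finite \<open>S\<close> the ball is finite, so this is a genuine maximum as soon as \<open>S\<close> generates a
  nontrivial group and \<open>n \<ge> 1\<close>. For the trivial group the value is an unspecified number that
  does not depend on \<open>n\<close>.
\<close>

definition rf_growth :: "('a, 'b) monoid_scheme \<Rightarrow> 'a set \<Rightarrow> nat \<Rightarrow> nat" where
  "rf_growth G S n = Max (normal_depth G ` (word_ball G S n - {\<one>\<^bsub>G\<^esub>}))"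

end

theory Submission
  imports Defs "HOL-Combinatorics.Permutations" "HOL-Library.Countable_Set"
begin

text \<open>
  Let \<open>d\<^sub>j = 2^(k\<^sub>j)\<close> and let \<open>G\<close> be the subgroup of the product of the groups \<open>Sym(Z/d\<^sub>j)\<close> generated by
  \<open>a = (q \<mapsto> q + 1)\<^sub>j\<close> and \<open>b = ((0, x\<^sub>j, 2 x\<^sub>j + 1))\<^sub>j\<close>, where \<open>x\<^sub>j = 2^(j + 1)\<close>. The commutator of \<open>b\<close> with its
  conjugate by \<open>a^(2^(i + 1))\<close> has length of order \<open>2^i\<close> and is nontrivial in the \<open>i\<close>-th factor only, so
  by the simplicity of the alternating group its normal depth is at least \<open>d\<^sub>i! / 2\<close>. Conversely, if
  \<open>x\<^sub>j > 2 n\<close>, the ball of radius \<open>n\<close> in the \<open>j\<close>-th factor looks like that of the lamplighter group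
  \<open>Z/3 wr Z\<close>; hence a nontrivial word of length \<open>n\<close> is already nontrivial in some factor with \<open>2^j\<close> of
  order at most \<open>n\<close> and its depth is at most \<open>d\<^sub>j!\<close>. It remains to choose \<open>d\<^sub>j \<ge> 8 x\<^sub>j\<close> with \<open>d\<^sub>j!\<close> comparable to
  \<open>F(2^j)\<close>, which hypotheses (a) and (b) allow.
\<close>

section \<open>Permutation groups containing 3-cycles\<close>

text \<open>With repeated arguments this need not be injective, so distinctness is carried along as
  a separate hypothesis.\<close>

definition cyc3 :: "'a \<Rightarrow> 'a \<Rightarrow> 'a \<Rightarrow> 'a \<Rightarrow> 'a" where
  "cyc3 a b c q = (if q = a then b else if q = b then c else if q = c then a else q)"

text \<open>For a group \<open>Q\<close> of permutations of a finite \<open>S\<close> this says that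
  \<open>Q\<close> contains the alternating group of \<open>S\<close>, expressed through its
  generators so that no sign has to be defined.\<close>

definition contains_cyc3 :: "'a set \<Rightarrow> ('a \<Rightarrow> 'a) set \<Rightarrow> bool" where
  "contains_cyc3 S Q \<longleftrightarrow>
     (\<forall>a b c. {a, b, c} \<subseteq> S \<longrightarrow> distinct [a, b, c] \<longrightarrow> cyc3 a b c \<in> Q)"

lemma contains_cyc3D:
  "\<lbrakk>contains_cyc3 S Q; a \<in> S; b \<in> S; c \<in> S; a \<noteq> b; b \<noteq> c; a \<noteq> c\<rbrakk> \<Longrightarrow> cyc3 a b c \<in> Q"
  unfolding contains_cyc3_def by auto

lemma cyc3_rotate: "distinct [a, b, c] \<Longrightarrow> cyc3 a b c = cyc3 b c a"
  by (auto simp: cyc3_def fun_eq_iff)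

lemma cyc3_comp_inverse:
  "distinct [a, b, c] \<Longrightarrow> cyc3 a b c \<circ> cyc3 c b a = id"
  by (auto simp: cyc3_def fun_eq_iff)

lemma comp_cyc3: "inj f \<Longrightarrow> f \<circ> cyc3 a b c = cyc3 (f a) (f b) (f c) \<circ> f"
  by (auto simp: cyc3_def fun_eq_iff inj_eq)

lemma inv_cyc3: "distinct [a, b, c] \<Longrightarrow> inv_into UNIV (cyc3 a b c) = cyc3 c b a"
  using cyc3_comp_inverse[of a b c] cyc3_comp_inverse[of c b a]
  by (intro inv_unique_comp) auto

lemma transpose_comp_transpose:
  "distinct [a, b, c] \<Longrightarrow> Transposition.transpose a b \<circ> Transposition.transpose b c = cyc3 a b c"
  by (auto simp: cyc3_def fun_eq_iff Transposition.transpose_def)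

lemma cyc3_permutes: "\<lbrakk>distinct [a, b, c]; {a, b, c} \<subseteq> S\<rbrakk> \<Longrightarrow> cyc3 a b c permutes S"
  unfolding transpose_comp_transpose[symmetric]
  by (intro permutes_compose permutes_swap_id) auto

lemma cyc3_commute:
  "{a, b, c} \<inter> {a', b', c'} = {} \<Longrightarrow> cyc3 a b c \<circ> cyc3 a' b' c' = cyc3 a' b' c' \<circ> cyc3 a b c"
  by (auto simp: cyc3_def fun_eq_iff)

lemma obtain_fresh:
  assumes "length xs < card S"
  obtains z where "z \<in> S" "z \<notin> set xs"
  using assms card_mono[of "set xs" S] card_length[of xs] by (metis List.finite_set not_le order_trans subsetI)

section \<open>Permutation groups and criteria for containing all 3-cycles\<close>

locale perm_group_on =
  fixes S :: "'a set" and Q :: "('a \<Rightarrow> 'a) set"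
  assumes permutes: "p \<in> Q \<Longrightarrow> p permutes S"
    and comp: "p \<in> Q \<Longrightarrow> q \<in> Q \<Longrightarrow> p \<circ> q \<in> Q"
    and inverse: "p \<in> Q \<Longrightarrow> inv_into UNIV p \<in> Q"
begin

lemma id_in: "p \<in> Q \<Longrightarrow> id \<in> Q"
  using comp[of p "inv_into UNIV p"] inverse permutes_inv_o(1)[OF permutes] by metis

lemma cyc3_inverse_in: "\<lbrakk>distinct [a, b, c]; cyc3 a b c \<in> Q\<rbrakk> \<Longrightarrow> cyc3 c b a \<in> Q"
  using inverse inv_cyc3 by metis

lemma cyc3_conj_in:
  assumes "p \<in> Q" "cyc3 a b c \<in> Q"
  shows "cyc3 (p a) (p b) (p c) \<in> Q"
proof -
  have "p \<circ> cyc3 a b c \<circ> inv_into UNIV p = cyc3 (p a) (p b) (p c) \<circ> (p \<circ> inv_into UNIV p)"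
    using comp_cyc3[OF permutes_inj[OF permutes[OF assms(1)]]] by (simp add: comp_assoc)
  also have "\<dots> = cyc3 (p a) (p b) (p c)"
    using permutes_inv_o(1)[OF permutes[OF assms(1)]] by simp
  finally show ?thesis
    using comp inverse assms by metis
qed

text \<open>A transposition \<open>t\<close> multiplied by any other transposition is a product of 3-cycles, so the
  symmetric group is \<open>Q \<union> t Q\<close>; this avoids the sign homomorphism.\<close>

lemma fact_card_le:
  assumes "finite S" "contains_cyc3 S Q" "a0 \<in> S" "b0 \<in> S" "a0 \<noteq> b0" "id \<in> Q"
  shows "fact (card S) \<le> 2 * card Q"
proof -
  let ?t = "Transposition.transpose :: 'a \<Rightarrow> 'a \<Rightarrow> 'a \<Rightarrow> 'a"
  have three: "?t a b \<circ> ?t b c \<in> Q" if "{a, b, c} \<subseteq> S" "a \<noteq> b" "b \<noteq> c" for a b c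
  proof (cases "a = c")
    case True
    then show ?thesis using assms(6) by (simp add: transpose_commute[of b c])
  next
    case False
    then show ?thesis
      using that transpose_comp_transpose[of a b c] contains_cyc3D[OF assms(2), of a b c] by auto
  qed
  have two: "?t a b \<circ> ?t c d \<in> Q" if "{a, b, c, d} \<subseteq> S" "a \<noteq> b" "c \<noteq> d" for a b c d
  proof (cases "b = c")
    case True
    then show ?thesis using three[of a b d] that by auto
  next
    case False
    \<comment> \<open>Inserting the transposition of \<open>b\<close> and \<open>c\<close> twice
      splits the product into two products of transpositions that share a point.\<close>
    have "?t a b \<circ> ?t c d = (?t a b \<circ> ?t b c) \<circ> (?t b c \<circ> ?t c d)"
      by (auto simp: fun_eq_iff)
    then show ?thesis using comp three[of a b c] three[of b c d] that False by auto
  qed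
  have "p \<in> Q \<union> (\<lambda>q. ?t a0 b0 \<circ> q) ` Q" if "p permutes S" for p
    using that assms(1)
  proof (induction rule: permutes_induct)
    case id
    then show ?case using assms(6) by blast
  next
    case (swap c d p)
    consider "p \<in> Q" | q where "q \<in> Q" "p = ?t a0 b0 \<circ> q" using swap by blast
    then show ?case
    proof cases
      case 1
      have "?t c d \<circ> p = ?t a0 b0 \<circ> ((?t a0 b0 \<circ> ?t c d) \<circ> p)"
        by (auto simp: fun_eq_iff)
      then show ?thesis using comp[OF two[of a0 b0 c d] 1] swap assms by blast
    next
      case 2
      then have "?t c d \<circ> p = (?t c d \<circ> ?t a0 b0) \<circ> q" by (simp add: comp_assoc)
      moreover have "?t c d \<circ> ?t a0 b0 \<in> Q" using two[of c d a0 b0] swap assms by auto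
      ultimately have "?t c d \<circ> p \<in> Q" using comp[OF _ 2(1)] by metis
      then show ?thesis by blast
    qed
  qed
  then have sub: "{p. p permutes S} \<subseteq> Q \<union> (\<lambda>q. ?t a0 b0 \<circ> q) ` Q" by blast
  have fin: "finite Q"
    using finite_subset[OF _ finite_permutations[OF assms(1)]] permutes by blast
  have "fact (card S) = card {p. p permutes S}"
    using assms(1) by (simp add: card_permutations)
  also have "\<dots> \<le> card (Q \<union> (\<lambda>q. ?t a0 b0 \<circ> q) ` Q)"
    using sub fin by (intro card_mono) auto
  also have "\<dots> \<le> card Q + card ((\<lambda>q. ?t a0 b0 \<circ> q) ` Q)" by (rule card_Un_le)
  also have "\<dots> \<le> 2 * card Q" using card_image_le[OF fin] by (simp add: mult_2)
  finally show ?thesis .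
qed

text \<open>Essentially the simplicity of the alternating group. The commutator of \<open>h\<close> with a suitable
  3-cycle is nontrivial and moves at most six points; its commutator with a 3-cycle having two
  points outside its support is a 3-cycle.\<close>

lemma contains_cyc3_if_normal:
  assumes "finite S" "9 \<le> card S"
    and conj: "\<And>p a b c. \<lbrakk>p \<in> Q; {a, b, c} \<subseteq> S; distinct [a, b, c]\<rbrakk> \<Longrightarrow>
      cyc3 a b c \<circ> p \<circ> cyc3 c b a \<in> Q"
    and "h \<in> Q" "h \<noteq> id"
  shows "contains_cyc3 S Q"
proof -
  \<comment> \<open>The commutator of \<open>p\<close> with a 3-cycle is \<open>p\<close> times a
    conjugate of its inverse, so it lies in \<open>Q\<close> even if the 3-cycle does not.\<close>
  have commutator: "cyc3 (p a) (p b) (p c) \<circ> cyc3 c b a \<in> Q"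
    if "p \<in> Q" "{a, b, c} \<subseteq> S" "distinct [a, b, c]" for p a b c
  proof -
    have "p \<circ> (cyc3 a b c \<circ> inv_into UNIV p \<circ> cyc3 c b a) =
        (p \<circ> cyc3 a b c) \<circ> inv_into UNIV p \<circ> cyc3 c b a"
      by (simp add: comp_assoc)
    also have "\<dots> = cyc3 (p a) (p b) (p c) \<circ> (p \<circ> inv_into UNIV p) \<circ> cyc3 c b a"
      using comp_cyc3[OF permutes_inj[OF permutes[OF that(1)]]] by (simp add: comp_assoc)
    also have "\<dots> = cyc3 (p a) (p b) (p c) \<circ> cyc3 c b a"
      using permutes_inv_o(1)[OF permutes[OF that(1)]] by simp
    finally show ?thesis using comp[OF that(1) conj[OF inverse[OF that(1)] that(2,3)]] by simp
  qed
  obtain a where a: "h a \<noteq> a" using assms(5) by (auto simp: fun_eq_iff)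
  have hS: "h permutes S" using permutes assms(4) .
  have aS: "a \<in> S" using a hS by (meson permutes_not_in)
  define b where "b = h a"
  have bS: "b \<in> S" unfolding b_def using aS hS by (simp add: permutes_in_image)
  obtain c where c: "c \<in> S" "c \<notin> set [a, b]"
    by (rule obtain_fresh[of "[a, b]" S]) (use assms(2) in auto)
  obtain e where e: "e \<in> S" "e \<notin> set [a, b, c]"
    by (rule obtain_fresh[of "[a, b, c]" S]) (use assms(2) in auto)
  \<comment> \<open>This is the commutator of \<open>h\<close> with the 3-cycle on \<open>a\<close>,
    \<open>c\<close>, \<open>e\<close>. As \<open>b\<close> differs from these three points,
    \<open>u\<close> sends \<open>b\<close> to \<open>h c\<close>, which is not
    \<open>b\<close>.\<close>
  define u where "u = cyc3 b (h c) (h e) \<circ> cyc3 e c a"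
  have uQ: "u \<in> Q" unfolding u_def b_def using commutator[of h a c e] assms(4) aS c e by auto
  have hc: "h c \<noteq> b" using c(2) inj_eq[OF permutes_inj[OF hS], of c a] unfolding b_def by simp
  then have ub: "u b \<noteq> b"
    using c e a unfolding u_def b_def by (auto simp: cyc3_def)
  define X where "X = set [a, b, c, e, h c, h e]"
  have out: "u q = q" if "q \<notin> X" for q
    using that unfolding u_def X_def by (auto simp: cyc3_def)
  have uS: "u permutes S" using permutes uQ .
  define v where "v = u b"
  have vb: "v \<noteq> b" using ub v_def by simp
  have vX: "v \<in> X" using out[of v] ub uS v_def by (metis permutes_inj inj_eq)
  have vS: "v \<in> S" unfolding v_def using bS uS by (simp add: permutes_in_image)
  obtain x where x: "x \<in> S" "x \<notin> X"
    by (rule obtain_fresh[of "[a, b, c, e, h c, h e]" S]) (use assms(2) in \<open>auto simp: X_def\<close>)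
  obtain y where y: "y \<in> S" "y \<notin> insert x X"
    by (rule obtain_fresh[of "[x, a, b, c, e, h c, h e]" S]) (use assms(2) in \<open>auto simp: X_def\<close>)
  have bX: "b \<in> X" unfolding X_def by simp
  have "cyc3 v x y \<circ> cyc3 y x b \<in> Q"
    using commutator[of u b x y] uQ bS x y bX out[of x] out[of y] v_def by auto
  moreover have "cyc3 v x y \<circ> cyc3 y x b = cyc3 b v x"
    using vb vX bX x y by (auto simp: cyc3_def fun_eq_iff)
  ultimately have start: "cyc3 b v x \<in> Q" by simp
  \<comment> \<open>Conjugation by a 3-cycle that sends \<open>r\<close> to \<open>r'\<close> and
    fixes \<open>p\<close> and \<open>q\<close> exchanges one entry; the fresh point
    \<open>z\<close> completes that 3-cycle.\<close>
  have change: "cyc3 p q r' \<in> Q"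
    if "cyc3 p q r \<in> Q" "{p, q, r, r'} \<subseteq> S" "distinct [p, q, r]" "distinct [p, q, r']" "r \<noteq> r'"
    for p q r r'
  proof -
    obtain z where z: "z \<in> S" "z \<notin> set [p, q, r, r']"
      by (rule obtain_fresh[of "[p, q, r, r']" S]) (use assms(2) in auto)
    have "cyc3 r r' z \<circ> cyc3 p q r \<circ> cyc3 z r' r = cyc3 p q r'"
      using that z by (auto simp: cyc3_def fun_eq_iff)
    then show ?thesis using conj[OF that(1), of r r' z] that z by auto
  qed
  have all: "cyc3 p q r \<in> Q" if pqr: "{p, q, r} \<subseteq> S" "distinct [p, q, r]" "{p, q, r} \<inter> {b, v, x} = {}" for p q r
  proof -
    have bvx: "{b, v, x} \<subseteq> S" "distinct [b, v, x]" using bS vS x vb vX bX by auto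
    have "cyc3 b v r \<in> Q" using change[OF start, of r] that bvx by auto
    then have "cyc3 r b v \<in> Q" using cyc3_rotate[of r b v] that bvx by auto
    then have "cyc3 r b q \<in> Q" using change[of r b v q] that bvx by auto
    then have "cyc3 q r b \<in> Q" using cyc3_rotate[of q r b] that bvx by auto
    then have "cyc3 q r p \<in> Q" using change[of q r b p] that bvx by auto
    then show ?thesis using cyc3_rotate[of p q r] that by auto
  qed
  show ?thesis unfolding contains_cyc3_def
  proof (intro allI impI)
    fix p q r assume pqr: "{p, q, r} \<subseteq> S" "distinct [p, q, r]"
    let ?A = "set [b, v, x, p, q, r]"
    \<comment> \<open>A triple that may meet \<open>b\<close>, \<open>v\<close>, \<open>x\<close> is
      reached through a third triple disjoint from both, so that entries exchanged one at a time
      never collide.\<close>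
    obtain p' where p': "p' \<in> S" "p' \<notin> ?A"
      by (rule obtain_fresh[of "[b, v, x, p, q, r]" S]) (use assms(2) in auto)
    obtain q' where q': "q' \<in> S" "q' \<notin> insert p' ?A"
      by (rule obtain_fresh[of "[p', b, v, x, p, q, r]" S]) (use assms(2) in auto)
    \<comment> \<open>Eight points are avoided here, more than anywhere else in the proof; this is
      the source of the bound 9 on \<open>card S\<close>.\<close>
    obtain r' where r': "r' \<in> S" "r' \<notin> insert q' (insert p' ?A)"
      by (rule obtain_fresh[of "[q', p', b, v, x, p, q, r]" S]) (use assms(2) in auto)
    have "cyc3 p' q' r' \<in> Q" using all[of p' q' r'] p' q' r' by auto
    then have "cyc3 p' q' r \<in> Q" using change[of p' q' r' r] p' q' r' pqr by auto
    then have "cyc3 r p' q' \<in> Q" using cyc3_rotate[of r p' q'] p' q' r' pqr by auto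
    then have "cyc3 r p' q \<in> Q" using change[of r p' q' q] p' q' r' pqr by auto
    then have "cyc3 q r p' \<in> Q" using cyc3_rotate[of q r p'] p' q' r' pqr by auto
    then have "cyc3 q r p \<in> Q" using change[of q r p' p] p' q' r' pqr by auto
    then show "cyc3 p q r \<in> Q" using cyc3_rotate[of p q r] pqr by auto
  qed
qed

text \<open>The 3-cycles on \<open>U\<close> fix \<open>v\<close>. Conjugating the given 3-cycle by
  them and taking inverses reaches every 3-cycle through \<open>v\<close>.\<close>

lemma contains_cyc3_insert:
  assumes "contains_cyc3 U Q" "v \<notin> U" "p \<in> U" "q \<in> U" "p \<noteq> q" "cyc3 v p q \<in> Q"
  shows "contains_cyc3 (insert v U) Q"
proof -
  have swap: "cyc3 v b a \<in> Q" if "cyc3 v a b \<in> Q" "a \<in> U" "b \<in> U" "a \<noteq> b" for a b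
  proof -
    have "v \<noteq> a" "v \<noteq> b" using assms(2) that by auto
    then show ?thesis using cyc3_inverse_in[of v a b] cyc3_rotate[of v b a] that by auto
  qed
  have change: "cyc3 v a c \<in> Q"
    if "cyc3 v a b \<in> Q" "a \<in> U" "b \<in> U" "c \<in> U" "a \<noteq> b" "a \<noteq> c" for a b c
  proof (cases "b = c")
    case False
    have "cyc3 b a c \<in> Q" using contains_cyc3D[OF assms(1)] that False by auto
    from cyc3_conj_in[OF this that(1)] have "cyc3 v c a \<in> Q"
      using that assms(2) False by (auto simp: cyc3_def split: if_splits)
    then show ?thesis using swap[of c a] that by auto
  qed (use that in simp)
  have all: "cyc3 v a b \<in> Q" if "a \<in> U" "b \<in> U" "a \<noteq> b" for a b
  proof (cases "a = p")
    case True
    then show ?thesis using change[OF assms(6), of b] assms that by auto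
  next
    case False
    have "cyc3 v p a \<in> Q" using change[OF assms(6), of a] assms that False by auto
    then have "cyc3 v a p \<in> Q" using swap[of p a] assms that False by auto
    then show ?thesis using change[of a p b] assms that False by auto
  qed
  show ?thesis unfolding contains_cyc3_def
  proof (intro allI impI)
    fix a b c assume abc: "{a, b, c} \<subseteq> insert v U" "distinct [a, b, c]"
    consider "a = v" | "b = v" | "c = v" | "{a, b, c} \<subseteq> U" using abc by auto
    then show "cyc3 a b c \<in> Q"
    proof cases
      case 1 then show ?thesis using all[of b c] abc by auto
    next
      case 2 then show ?thesis using all[of c a] cyc3_rotate[of a b c] abc by auto
    next
      case 3 then show ?thesis using all[of a b] cyc3_rotate[of c a b] abc by auto
    next
      case 4 then show ?thesis using contains_cyc3D[OF assms(1)] abc by auto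
    qed
  qed
qed

text \<open>Consider a maximal set on which \<open>Q\<close> contains all 3-cycles: any 3-cycle meeting it without
  being contained in it would enlarge it.\<close>

lemma contains_cyc3_if_connected:
  assumes "finite S" "{a0, b0, c0} \<subseteq> S" "distinct [a0, b0, c0]" "cyc3 a0 b0 c0 \<in> Q"
    and step: "\<And>u. u \<in> S \<Longrightarrow> f u \<in> S \<and> g u \<in> S \<and> distinct [u, f u, g u] \<and> cyc3 u (f u) (g u) \<in> Q"
    and reach: "\<And>U. \<lbrakk>a0 \<in> U; \<And>u. u \<in> U \<Longrightarrow> u \<in> S \<Longrightarrow> g u \<in> U\<rbrakk> \<Longrightarrow> S \<subseteq> U"
  shows "contains_cyc3 S Q"
proof -
  let ?P = "\<lambda>U. U \<subseteq> S \<and> {a0, b0, c0} \<subseteq> U \<and> contains_cyc3 U Q"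
  have "cyc3 a b c \<in> Q" if "{a, b, c} \<subseteq> {a0, b0, c0}" "distinct [a, b, c]" for a b c
  proof -
    have r: "cyc3 b0 c0 a0 \<in> Q" "cyc3 c0 a0 b0 \<in> Q"
      using assms(3,4) cyc3_rotate[of a0 b0 c0] cyc3_rotate[of c0 a0 b0] by auto
    have "cyc3 c0 b0 a0 \<in> Q" "cyc3 a0 c0 b0 \<in> Q" "cyc3 b0 a0 c0 \<in> Q"
      using cyc3_inverse_in[OF _ assms(4)] cyc3_inverse_in[OF _ r(1)] cyc3_inverse_in[OF _ r(2)]
        assms(3) by auto
    then show ?thesis using that r assms(4) by auto
  qed
  then have "contains_cyc3 {a0, b0, c0} Q" unfolding contains_cyc3_def by blast
  then have "?P {a0, b0, c0}" using assms(2) by blast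
  moreover have "\<forall>V. ?P V \<longrightarrow> card V < Suc (card S)"
    using card_mono[OF assms(1)] by (simp add: less_Suc_eq_le)
  ultimately have "\<exists>U. ?P U \<and> (\<forall>V. ?P V \<longrightarrow> card V \<le> card U)"
    by (rule ex_has_greatest_nat)
  then obtain U where U: "?P U" and max: "\<And>V. ?P V \<Longrightarrow> card V \<le> card U"
    by blast
  have no_ext: False if "v \<in> S" "v \<notin> U" "p \<in> U" "q \<in> U" "p \<noteq> q" "cyc3 v p q \<in> Q" for v p q
  proof -
    have "?P (insert v U)" using contains_cyc3_insert[of U v p q] that U by auto
    from max[OF this] show False
      using that(2) finite_subset[OF _ assms(1)] U by (simp add: card_insert_if)
  qed
  have closed: "g u \<in> U" if u: "u \<in> U" for u
  proof (rule ccontr)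
    assume gu: "g u \<notin> U"
    have uS: "u \<in> S" using U u by auto
    note st = step[OF uS]
    show False
    proof (cases "f u \<in> U")
      case True
      have "cyc3 (g u) u (f u) \<in> Q" using st cyc3_rotate[of "g u" u "f u"] by auto
      then show False using no_ext[of "g u" u "f u"] st True u gu by auto
    next
      case False
      \<comment> \<open>Here neither \<open>f u\<close> nor \<open>g u\<close> lies in
        \<open>U\<close>, so conjugating a 3-cycle of \<open>U\<close> through \<open>u\<close> by
        the given one replaces \<open>u\<close> by \<open>f u\<close> and keeps the other two
        points.\<close>
      obtain p q where pq: "p \<in> U" "q \<in> U" "p \<noteq> q" "p \<noteq> u" "q \<noteq> u"
        using U assms(3) by (cases "u = a0"; cases "u = b0") auto
      have "cyc3 u p q \<in> Q" using contains_cyc3D[of U Q u p q] U u pq by auto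
      from cyc3_conj_in[OF _ this, of "cyc3 u (f u) (g u)"] have "cyc3 (f u) p q \<in> Q"
        using st pq False gu by (auto simp: cyc3_def split: if_splits)
      then show False using no_ext[of "f u" p q] st pq False by auto
    qed
  qed
  have "S \<subseteq> U" using reach[of U] U closed by auto
  then show ?thesis using U by (metis subset_antisym)
qed

end

section \<open>Translates of a 3-cycle modulo \<open>d\<close>\<close>

definition shift :: "int \<Rightarrow> int \<Rightarrow> int \<Rightarrow> int" where
  "shift d e q = (if q \<in> {0..<d} then (q + e) mod d else q)"

text \<open>\<open>pos x d s i\<close> is the image under the shift by \<open>s\<close> of the \<open>i\<close>-th point of the 3-cycle
  \<open>(0, x, 2 x + 1)\<close> of residues modulo \<open>d\<close>.\<close>

definition pos :: "int \<Rightarrow> int \<Rightarrow> int \<Rightarrow> nat \<Rightarrow> int" where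
  "pos x d s i = (s + (if i = 0 then 0 else if i = 1 then x else 2 * x + 1)) mod d"

lemma shift_comp_shift: "shift d e \<circ> shift d e' = shift d (e + e')"
  by (auto simp: shift_def fun_eq_iff mod_add_right_eq add_ac)

lemma shift_zero: "shift d 0 = id"
  by (auto simp: shift_def fun_eq_iff)

lemma shift_pos: "0 < d \<Longrightarrow> shift d e (pos x d s i) = pos x d (s + e) i"
  by (simp add: pos_def shift_def mod_add_right_eq add_ac)

lemma zero_if_dvd_small: "\<lbrakk>(d::int) dvd z; \<bar>z\<bar> < d\<rbrakk> \<Longrightarrow> z = 0"
  using dvd_imp_le_int[of z d] by linarith

text \<open>The three offsets differ pairwise by at least \<open>x\<close>, more than the two shifts
  do, and all differences are too small to wrap around modulo \<open>d\<close>. So translates whose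
  shifts are distinct but differ by less than \<open>x\<close> are disjoint.\<close>

lemma pos_eqD:
  assumes "8 * x \<le> d" "\<bar>s - s'\<bar> < x" "i < 3" "i' < 3" "pos x d s i = pos x d s' i'"
  shows "s = s'" "i = i'"
proof -
  define off where "off = (\<lambda>i::nat. if i = 0 then 0 else if i = 1 then x else 2 * x + 1)"
  have "(s + off i) mod d = (s' + off i') mod d"
    using assms(5) unfolding pos_def off_def .
  then have "d dvd (s + off i) - (s' + off i')"
    by (simp only: mod_eq_dvd_iff)
  moreover have "\<bar>(s + off i) - (s' + off i')\<bar> < d"
  proof -
    have "x \<ge> 1" using assms(2) by linarith
    then have "0 \<le> off n \<and> off n \<le> 2 * x + 1" for n by (simp add: off_def)
    from this[of i] this[of i'] show ?thesis using assms(1,2) by linarith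
  qed
  ultimately have "(s + off i) - (s' + off i') = 0"
    by (rule zero_if_dvd_small)
  then have eq: "s - s' = off i' - off i" by linarith
  have ii: "i = i'"
  proof (rule ccontr)
    assume ne: "i \<noteq> i'"
    have x: "x \<ge> 1" using assms(2) by linarith
    have three: "n = 0 \<and> off n = 0 \<or> n = 1 \<and> off n = x \<or> n = 2 \<and> off n = 2 * x + 1" if "n < 3" for n
      using that by (auto simp: off_def)
    have "x \<le> \<bar>off i' - off i\<bar>"
      using three[OF assms(3)] three[OF assms(4)] ne x by linarith
    then show False using eq assms(2) by linarith
  qed
  then show "i = i'" .
  show "s = s'" using eq unfolding ii by linarith
qed

lemma pos_zero:
  "\<lbrakk>0 < x; 8 * x \<le> d\<rbrakk> \<Longrightarrow> pos x d 0 0 = 0"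
  "\<lbrakk>0 < x; 8 * x \<le> d\<rbrakk> \<Longrightarrow> pos x d 0 (Suc 0) = x"
  "\<lbrakk>0 < x; 8 * x \<le> d\<rbrakk> \<Longrightarrow> pos x d 0 2 = 2 * x + 1"
  by (simp_all add: pos_def mod_pos_pos_trivial)

lemma cyc3_pos:
  assumes "0 < x" "8 * x \<le> d" "i < 3"
  shows "cyc3 0 x (2 * x + 1) (pos x d 0 i) = pos x d 0 ((i + 1) mod 3)"
    "cyc3 (2 * x + 1) x 0 (pos x d 0 i) = pos x d 0 ((i + 2) mod 3)"
proof -
  have "i = 0 \<or> i = Suc 0 \<or> i = 2" using assms(3) by auto
  then show "cyc3 0 x (2 * x + 1) (pos x d 0 i) = pos x d 0 ((i + 1) mod 3)"
    "cyc3 (2 * x + 1) x 0 (pos x d 0 i) = pos x d 0 ((i + 2) mod 3)"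
    using assms(1,2) by (auto simp: pos_zero[OF assms(1,2)] cyc3_def mod_Suc numeral_2_eq_2[symmetric])
qed

lemma cyc3_not_pos:
  assumes "0 < x" "8 * x \<le> d" "\<forall>i<3. q \<noteq> pos x d 0 i"
  shows "cyc3 0 x (2 * x + 1) q = q" "cyc3 (2 * x + 1) x 0 q = q"
  using assms(3)[rule_format, of 0] assms(3)[rule_format, of "Suc 0"] assms(3)[rule_format, of 2]
  by (simp_all add: pos_zero[OF assms(1,2)] cyc3_def)

text \<open>For \<open>i \<noteq> j\<close> the 2-adic valuation of the sum is
  \<open>min i j + 1\<close>, which is at most \<open>j + 1\<close> and hence less than
  \<open>k\<close>.\<close>

lemma not_power_of_two_dvd:
  assumes "i \<noteq> j" "j + 4 \<le> k" "z = 2 ^ (j + 1) \<or> z = - (2 ^ (j + 1) :: int)"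
  shows "\<not> 2 ^ k dvd (2 ^ (i + 1) + z)"
proof
  assume dvd: "2 ^ k dvd (2 ^ (i + 1) + z)"
  have small: "\<not> (2::int) ^ m dvd 2 ^ n" if "n < m" for m n :: nat
    using that zdvd_imp_le[of "2 ^ m" "2 ^ n"] power_strict_increasing[of n m "2::int"] by fastforce
  show False
  proof (cases "i < j")
    case True
    have "(2::int) ^ (j + 1) dvd 2 ^ k" using assms(2) by (intro le_imp_power_dvd) simp
    then have "2 ^ (j + 1) dvd (2 ^ (i + 1) + z)" using dvd dvd_trans by blast
    moreover have "2 ^ (j + 1) dvd z" using assms(3) by auto
    ultimately have "(2::int) ^ (j + 1) dvd 2 ^ (i + 1)" by (simp add: dvd_add_left_iff)
    then show False using small[of "i + 1" "j + 1"] True by simp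
  next
    case False
    have "(2::int) ^ (j + 2) dvd 2 ^ k" using assms(2) by (intro le_imp_power_dvd) simp
    then have "2 ^ (j + 2) dvd (2 ^ (i + 1) + z)" using dvd dvd_trans by blast
    moreover have "(2::int) ^ (j + 2) dvd 2 ^ (i + 1)"
      using assms(1) False by (intro le_imp_power_dvd) simp
    ultimately have "2 ^ (j + 2) dvd z" by (simp add: dvd_add_right_iff)
    then have "(2::int) ^ (j + 2) dvd 2 ^ (j + 1)" using assms(3) by (auto simp del: power_Suc)
    then show False using small[of "j + 1" "j + 2"] by simp
  qed
qed

section \<open>Word balls\<close>

context group
begin

lemma word_ball_subset_carrier: "S \<subseteq> carrier G \<Longrightarrow> word_ball G S n \<subseteq> carrier G"
proof
  fix g assume S: "S \<subseteq> carrier G" and "g \<in> word_ball G S n"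
  then obtain ss where ss: "set ss \<subseteq> S \<union> (\<lambda>s. inv\<^bsub>G\<^esub> s) ` S" "g = foldr (\<otimes>) ss \<one>"
    unfolding word_ball_def by blast
  have "foldr (\<otimes>) ss \<one> \<in> carrier G" using ss(1) S by (induction ss) auto
  then show "g \<in> carrier G" using ss by simp
qed

lemma foldr_mult_append:
  "\<lbrakk>set ss \<subseteq> carrier G; set ts \<subseteq> carrier G\<rbrakk> \<Longrightarrow>
    foldr (\<otimes>) (ss @ ts) \<one> = foldr (\<otimes>) ss \<one> \<otimes> foldr (\<otimes>) ts \<one>"
proof (induction ss)
  case Nil
  have "foldr (\<otimes>) ts \<one> \<in> carrier G" using Nil(2) by (induction ts) auto
  then show ?case by simp
next
  case (Cons s ss)
  have "foldr (\<otimes>) ss \<one> \<in> carrier G" using Cons(2) by (induction ss) auto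
  moreover have "foldr (\<otimes>) ts \<one> \<in> carrier G" using Cons(3) by (induction ts) auto
  ultimately show ?case using Cons by (simp add: m_assoc)
qed

lemma word_ball_mult:
  assumes "S \<subseteq> carrier G" "g \<in> word_ball G S m" "h \<in> word_ball G S n"
  shows "g \<otimes> h \<in> word_ball G S (m + n)"
proof -
  obtain ss where ss: "set ss \<subseteq> S \<union> (\<lambda>s. inv\<^bsub>G\<^esub> s) ` S" "g = foldr (\<otimes>) ss \<one>" "length ss \<le> m"
    using assms(2) unfolding word_ball_def by blast
  obtain ts where ts: "set ts \<subseteq> S \<union> (\<lambda>s. inv\<^bsub>G\<^esub> s) ` S" "h = foldr (\<otimes>) ts \<one>" "length ts \<le> n"
    using assms(3) unfolding word_ball_def by blast
  have "S \<union> (\<lambda>s. inv\<^bsub>G\<^esub> s) ` S \<subseteq> carrier G" using assms(1) by auto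
  then have "set ss \<subseteq> carrier G" "set ts \<subseteq> carrier G" using ss(1) ts(1) by blast+
  then have "g \<otimes> h = foldr (\<otimes>) (ss @ ts) \<one>"
    using foldr_mult_append[of ss ts] ss(2) ts(2) by simp
  then show ?thesis unfolding word_ball_def
    using ss ts by (intro CollectI exI[of _ "ss @ ts"] conjI) auto
qed

lemma word_ball_letter:
  "\<lbrakk>S \<subseteq> carrier G; s \<in> S \<union> (\<lambda>s. inv\<^bsub>G\<^esub> s) ` S\<rbrakk> \<Longrightarrow> s \<in> word_ball G S 1"
  unfolding word_ball_def by (intro CollectI exI[of _ "[s]"]) auto

lemma word_ball_mono: "m \<le> n \<Longrightarrow> word_ball G S m \<subseteq> word_ball G S n"
  unfolding word_ball_def by (auto intro: order_trans)

lemma one_in_word_ball: "\<one> \<in> word_ball G S n"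
  unfolding word_ball_def by (intro CollectI exI[of _ "[]"]) auto

lemma word_ball_pow:
  "\<lbrakk>S \<subseteq> carrier G; g \<in> word_ball G S m\<rbrakk> \<Longrightarrow> g [^] (n::nat) \<in> word_ball G S (m * n)"
proof (induction n)
  case (Suc n)
  then show ?case using word_ball_mult[of S "g [^] n" "m * n" g m] by (simp add: add.commute)
qed (simp add: one_in_word_ball)

lemma word_ball_inv:
  assumes S: "S \<subseteq> carrier G" and "g \<in> word_ball G S n"
  shows "inv\<^bsub>G\<^esub> g \<in> word_ball G S n"
proof -
  obtain ss where ss: "set ss \<subseteq> S \<union> (\<lambda>s. inv\<^bsub>G\<^esub> s) ` S" "g = foldr (\<otimes>) ss \<one>" "length ss \<le> n"
    using assms(2) unfolding word_ball_def by blast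
  have "inv\<^bsub>G\<^esub> (foldr (\<otimes>) ss \<one>) \<in> word_ball G S (length ss)" using ss(1)
  proof (induction ss)
    case Nil
    then show ?case by (simp add: one_in_word_ball)
  next
    case (Cons s ss)
    have *: "foldr (\<otimes>) ss \<one> \<in> carrier G"
      using word_ball_subset_carrier[OF S, of "length ss"] Cons(2) unfolding word_ball_def by auto
    have s: "s \<in> carrier G" using S Cons(2) by auto
    have "inv\<^bsub>G\<^esub> s \<in> S \<union> (\<lambda>s. inv\<^bsub>G\<^esub> s) ` S" using S Cons(2) by auto
    from word_ball_mult[OF S Cons.IH word_ball_letter[OF S this]] Cons(2)
    show ?case using * s by (simp add: inv_mult_group)
  qed
  then show ?thesis using ss(2) subsetD[OF word_ball_mono[OF ss(3)]] by simp
qed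

lemma word_ball_subset_word_ball:
  assumes S: "S \<subseteq> carrier G" and "T \<subseteq> word_ball G S m"
  shows "word_ball G T n \<subseteq> word_ball G S (m * n)"
proof
  fix g assume "g \<in> word_ball G T n"
  then obtain ss where ss: "set ss \<subseteq> T \<union> (\<lambda>s. inv\<^bsub>G\<^esub> s) ` T" "g = foldr (\<otimes>) ss \<one>" "length ss \<le> n"
    unfolding word_ball_def by blast
  have "foldr (\<otimes>) ss \<one> \<in> word_ball G S (m * length ss)" using ss(1)
  proof (induction ss)
    case (Cons s ss)
    then have "s \<in> word_ball G S m" using assms word_ball_inv[OF S] by auto
    from word_ball_mult[OF S this Cons.IH] Cons.prems show ?case by simp
  qed (simp add: one_in_word_ball)
  then show "g \<in> word_ball G S (m * n)"
    using ss(2) subsetD[OF word_ball_mono[OF mult_le_mono2[OF ss(3)]]] by simp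
qed

lemma finite_word_ball: "finite S \<Longrightarrow> finite (word_ball G S n)"
proof -
  assume "finite S"
  then have "finite {ss. set ss \<subseteq> S \<union> (\<lambda>s. inv\<^bsub>G\<^esub> s) ` S \<and> length ss \<le> n}"
    by (intro finite_lists_length_le) auto
  then have "finite ((\<lambda>ss. foldr (\<otimes>) ss \<one>) ` {ss. set ss \<subseteq> S \<union> (\<lambda>s. inv\<^bsub>G\<^esub> s) ` S \<and> length ss \<le> n})"
    by (rule finite_imageI)
  then show ?thesis by (rule rev_finite_subset) (auto simp: word_ball_def)
qed

end

section \<open>Groups generated by shifts and 3-cycles\<close>

text \<open>The maps \<open>\<pi> j\<close> are the projections to the factors, and
  \<open>faithful\<close> embeds \<open>G\<close> into their product. The carrier stays abstract so
  that a copy on the natural numbers can be used. By \<open>k_ge\<close> the degree is at least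
  eight times \<open>2 ^ (j + 1)\<close>.\<close>

locale shift_cyc3_group = group G for G (structure) +
  fixes a b and k :: "nat \<Rightarrow> nat" and \<pi> :: "nat \<Rightarrow> 'a \<Rightarrow> int \<Rightarrow> int"
  assumes k_ge: "j + 4 \<le> k j"
    and a_closed [simp]: "a \<in> carrier G" and b_closed [simp]: "b \<in> carrier G"
    and generators: "generate G {a, b} = carrier G"
    and \<pi>_permutes: "g \<in> carrier G \<Longrightarrow> \<pi> j g permutes {0..<2 ^ k j}"
    and \<pi>_mult: "\<lbrakk>g \<in> carrier G; h \<in> carrier G\<rbrakk> \<Longrightarrow> \<pi> j (g \<otimes> h) = \<pi> j g \<circ> \<pi> j h"
    and \<pi>_a: "\<pi> j a = shift (2 ^ k j) 1"
    and \<pi>_b: "\<pi> j b = cyc3 0 (2 ^ (j + 1)) (2 * 2 ^ (j + 1) + 1)"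
    and faithful: "\<lbrakk>g \<in> carrier G; \<And>j. \<pi> j g = id\<rbrakk> \<Longrightarrow> g = \<one>"
begin

section \<open>Action of words on the factors and comparison with the lamplighter group\<close>

lemma d_ge: "8 * 2 ^ (j + 1) \<le> (2::int) ^ k j"
proof -
  have "(2::int) ^ (j + 4) \<le> 2 ^ k j" using k_ge by (intro power_increasing) auto
  then show ?thesis by (simp add: power_add)
qed

lemma \<pi>_bij: "g \<in> carrier G \<Longrightarrow> bij (\<pi> j g)"
  using \<pi>_permutes permutes_bij by blast

lemma \<pi>_one: "\<pi> j \<one> = id"
proof -
  have "\<pi> j \<one> \<circ> \<pi> j \<one> = \<pi> j \<one>" using \<pi>_mult[of \<one> \<one>] by simp
  then have "\<pi> j \<one> (\<pi> j \<one> q) = \<pi> j \<one> q" for q by (metis comp_apply)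
  then show ?thesis using injD[OF bij_is_inj[OF \<pi>_bij[of \<one> j]]] by fastforce
qed

lemma \<pi>_inv: "g \<in> carrier G \<Longrightarrow> \<pi> j (inv\<^bsub>G\<^esub> g) = inv_into UNIV (\<pi> j g)"
  using \<pi>_mult[of g "inv\<^bsub>G\<^esub> g" j] \<pi>_mult[of "inv\<^bsub>G\<^esub> g" g j] \<pi>_one
  by (intro inv_unique_comp[symmetric]) auto

lemma \<pi>_inv_a: "\<pi> j (inv\<^bsub>G\<^esub> a) = shift (2 ^ k j) (- 1)"
  using shift_comp_shift[of "2 ^ k j" 1 "-1"] shift_comp_shift[of "2 ^ k j" "-1" 1]
  by (subst \<pi>_inv, simp) (intro inv_unique_comp, auto simp: \<pi>_a shift_zero)

lemma \<pi>_inv_b: "\<pi> j (inv\<^bsub>G\<^esub> b) = cyc3 (2 * 2 ^ (j + 1) + 1) (2 ^ (j + 1)) 0"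
proof -
  have "distinct [0, x, 2 * x + 1]" if "0 < x" for x :: int
    using that by auto
  from this[of "2 ^ (j + 1)"] show ?thesis by (simp add: \<pi>_inv \<pi>_b inv_cyc3 del: power_Suc)
qed

lemma \<pi>_pow_a: "\<pi> j (a [^] (n::nat)) = shift (2 ^ k j) (int n)"
  by (induction n) (simp_all add: \<pi>_one shift_zero \<pi>_mult \<pi>_a shift_comp_shift add.commute)

text \<open>A word of length at most \<open>N\<close> acts like an element of the lamplighter group over \<open>Z/3\<close>: a total
  shift \<open>e\<close> together with \<open>c s\<close> turns of the 3-cycle translated by \<open>s\<close>. The point is that \<open>c\<close> and \<open>e\<close>
  do not depend on \<open>j\<close>, as long as \<open>j\<close> is so large that the translates by \<open>|s| \<le> N\<close> are disjoint.\<close>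

lemma word_normal_form:
  assumes "length ss \<le> N" "set ss \<subseteq> {a, b} \<union> (\<lambda>s. inv\<^bsub>G\<^esub> s) ` {a, b}"
  shows "\<exists>c :: int \<Rightarrow> nat. \<exists>e. \<bar>e\<bar> \<le> int (length ss) \<and>
    (\<forall>j. 2 * int N < 2 ^ (j + 1) \<longrightarrow>
      (\<forall>s i. \<bar>s\<bar> \<le> int N \<longrightarrow> i < 3 \<longrightarrow>
        \<pi> j (foldr (\<otimes>) ss \<one>) (pos (2 ^ (j + 1)) (2 ^ k j) s i) =
        pos (2 ^ (j + 1)) (2 ^ k j) (s + e) ((i + c s) mod 3)) \<and>
      (\<forall>q \<in> {0..<2 ^ k j}.
        (\<forall>s i. \<bar>s\<bar> \<le> int N \<longrightarrow> i < 3 \<longrightarrow> q \<noteq> pos (2 ^ (j + 1)) (2 ^ k j) s i) \<longrightarrow>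
        \<pi> j (foldr (\<otimes>) ss \<one>) q = (q + e) mod 2 ^ k j))"
  using assms
proof (induction ss)
  case Nil
  show ?case by (intro exI[of _ "\<lambda>_. 0"] exI[of _ 0]) (auto simp: \<pi>_one)
next
  case (Cons l ss)
  let ?P = "\<lambda>j. pos (2 ^ (j + 1)) (2 ^ k j)"
  let ?w = "foldr (\<otimes>) ss \<one>"
  obtain c e where e: "\<bar>e\<bar> \<le> int (length ss)"
    and on: "\<And>j s i. \<lbrakk>2 * int N < 2 ^ (j + 1); \<bar>s\<bar> \<le> int N; i < 3\<rbrakk> \<Longrightarrow>
        \<pi> j ?w (?P j s i) = ?P j (s + e) ((i + c s) mod 3)"
    and off: "\<And>j q. \<lbrakk>2 * int N < 2 ^ (j + 1); q \<in> {0..<2 ^ k j};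
          \<And>s i. \<lbrakk>\<bar>s\<bar> \<le> int N; i < 3\<rbrakk> \<Longrightarrow> q \<noteq> ?P j s i\<rbrakk> \<Longrightarrow> \<pi> j ?w q = (q + e) mod 2 ^ k j"
    using Cons by auto
  have wG: "?w \<in> carrier G" using Cons.prems(2)
    by (intro word_ball_subset_carrier[THEN subsetD, of "{a, b}" ?w "length ss"])
      (auto simp: word_ball_def)
  have lG: "l \<in> carrier G" using Cons.prems(2) by auto
  have l: "l = a \<or> l = inv\<^bsub>G\<^esub> a \<or> l = b \<or> l = inv\<^bsub>G\<^esub> b" using Cons.prems(2) by auto
  have app: "\<pi> j (foldr (\<otimes>) (l # ss) \<one>) q = \<pi> j l (\<pi> j ?w q)" for j q
    using \<pi>_mult[OF lG wG] by simp
  consider (sh) t where "\<bar>t\<bar> = 1" "\<And>j. \<pi> j l = shift (2 ^ k j) t"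
    | (cy) t where "\<And>j i. i < 3 \<Longrightarrow> \<pi> j l (?P j 0 i) = ?P j 0 ((i + t) mod 3)"
      "\<And>j q. \<forall>i<3. q \<noteq> ?P j 0 i \<Longrightarrow> \<pi> j l q = q"
  proof -
    consider "l = a" | "l = inv\<^bsub>G\<^esub> a" | "l = b" | "l = inv\<^bsub>G\<^esub> b" using l by blast
    then show ?thesis
    proof cases
      case 1 then show ?thesis using sh[of 1] \<pi>_a by simp
    next
      case 2 then show ?thesis using sh[of "-1"] \<pi>_inv_a by simp
    next
      case 3
      have "\<pi> j l = cyc3 0 (2 ^ (j + 1)) (2 * 2 ^ (j + 1) + 1)" for j
        unfolding 3 by (rule \<pi>_b)
      then show ?thesis
        using cy[of 1] cyc3_pos(1)[OF zero_less_power d_ge] cyc3_not_pos(1)[OF zero_less_power d_ge]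
        by simp
    next
      case 4
      \<comment> \<open>The inverse of \<open>b\<close> counts as two turns, so the turn counts can
        stay natural numbers.\<close>
      have "\<pi> j l = cyc3 (2 * 2 ^ (j + 1) + 1) (2 ^ (j + 1)) 0" for j
        unfolding 4 by (rule \<pi>_inv_b)
      then show ?thesis
        using cy[of 2] cyc3_pos(2)[OF zero_less_power d_ge] cyc3_not_pos(2)[OF zero_less_power d_ge]
        by simp
    qed
  qed
  then show ?case
  proof cases
    case (sh t)
    show ?thesis
    proof (intro exI[of _ c] exI[of _ "e + t"] conjI allI impI ballI)
      show "\<bar>e + t\<bar> \<le> int (length (l # ss))" using e sh by auto
    next
      fix j s i assume "2 * int N < 2 ^ (j + 1)" "\<bar>s\<bar> \<le> int N" "i < (3::nat)"
      then show "\<pi> j (foldr (\<otimes>) (l # ss) \<one>) (?P j s i) = ?P j (s + (e + t)) ((i + c s) mod 3)"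
        using on[of j s i] unfolding app sh(2) by (simp add: shift_pos add.assoc)
    next
      fix j q assume "2 * int N < 2 ^ (j + 1)" "q \<in> {0..<2 ^ k j}"
        "\<forall>s i. \<bar>s\<bar> \<le> int N \<longrightarrow> i < 3 \<longrightarrow> q \<noteq> ?P j s i"
      then show "\<pi> j (foldr (\<otimes>) (l # ss) \<one>) q = (q + (e + t)) mod 2 ^ k j"
        using off[of j q] unfolding app sh(2) by (simp add: shift_def mod_simps add.assoc)
    qed
  next
    case (cy t)
    \<comment> \<open>The letter acts after the word \<open>ss\<close> and turns the translate now
      at position 0. After the total shift \<open>e\<close> this is the translate that started at
      \<open>- e\<close>.\<close>
    show ?thesis
    proof (intro exI[of _ "c(- e := c (- e) + t)"] exI[of _ e] conjI allI impI ballI)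
      show "\<bar>e\<bar> \<le> int (length (l # ss))" using e by auto
    next
      fix j s i assume j: "2 * int N < 2 ^ (j + 1)" and s: "\<bar>s\<bar> \<le> int N" and i: "i < (3::nat)"
      note on = on[OF j s i]
      show "\<pi> j (foldr (\<otimes>) (l # ss) \<one>) (?P j s i) =
          ?P j (s + e) ((i + (c(- e := c (- e) + t)) s) mod 3)"
      proof (cases "s = - e")
        case True
        then show ?thesis unfolding app on using cy(1)[of "(i + c s) mod 3" j]
          by (simp add: mod_simps add.assoc)
      next
        case False
        \<comment> \<open>Both \<open>s\<close> and \<open>e\<close> are at most \<open>N\<close> in
          absolute value; this accounts for the factor 2 in \<open>2 * int N\<close>.\<close>
        have "\<bar>s + e - 0\<bar> < 2 ^ (j + 1)"
        proof -
          have "int (length ss) \<le> int N" using Cons.prems(1) by simp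
          then show ?thesis using s e j by linarith
        qed
        then have "\<forall>i'<3. ?P j (s + e) ((i + c s) mod 3) \<noteq> ?P j 0 i'"
          using pos_eqD(1)[OF d_ge[of j], of "s + e" 0] False by force
        then show ?thesis unfolding app on using cy(2) False by simp
      qed
    next
      fix j q assume j: "2 * int N < 2 ^ (j + 1)" and q: "q \<in> {0..<2 ^ k j}"
        and out: "\<forall>s i. \<bar>s\<bar> \<le> int N \<longrightarrow> i < 3 \<longrightarrow> q \<noteq> ?P j s i"
      have "(q + e) mod 2 ^ k j \<noteq> ?P j 0 i" if "i < 3" for i
      proof
        assume "(q + e) mod 2 ^ k j = ?P j 0 i"
        then have "((q + e) mod 2 ^ k j - e) mod 2 ^ k j = (?P j 0 i - e) mod 2 ^ k j" by simp
        then have "q = ?P j (- e) i"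
          using q by (simp add: pos_def mod_simps algebra_simps)
        moreover have "int (length ss) \<le> int N" using Cons.prems(1) by simp
        then have "\<bar>- e\<bar> \<le> int N" using e by linarith
        ultimately show False using out that by blast
      qed
      then show "\<pi> j (foldr (\<otimes>) (l # ss) \<one>) q = (q + e) mod 2 ^ k j"
        unfolding app using off[OF j q] out cy(2) by auto
    qed
  qed
qed

text \<open>If the projections up to \<open>j0\<close> were all trivial, the normal form read off at
  \<open>j0\<close> would have total shift 0 and turn counts divisible by 3. The same shift and
  counts describe the action for every larger \<open>j\<close>, so the element would be
  trivial.\<close>

lemma detected_at_small_index:
  assumes "g \<in> word_ball G {a, b} N" "g \<noteq> \<one>" "2 * int N < 2 ^ (j0 + 1)"
  obtains j where "j \<le> j0" "\<pi> j g \<noteq> id"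
proof -
  obtain ss where ss: "length ss \<le> N" "set ss \<subseteq> {a, b} \<union> (\<lambda>s. inv\<^bsub>G\<^esub> s) ` {a, b}"
    "g = foldr (\<otimes>) ss \<one>"
    using assms(1) unfolding word_ball_def by blast
  let ?P = "\<lambda>j. pos (2 ^ (j + 1)) (2 ^ k j)"
  obtain c :: "int \<Rightarrow> nat" and e where e: "\<bar>e\<bar> \<le> int N"
    and on: "\<And>j s i. \<lbrakk>2 * int N < 2 ^ (j + 1); \<bar>s\<bar> \<le> int N; i < 3\<rbrakk> \<Longrightarrow>
        \<pi> j g (?P j s i) = ?P j (s + e) ((i + c s) mod 3)"
    and off: "\<And>j q. \<lbrakk>2 * int N < 2 ^ (j + 1); q \<in> {0..<2 ^ k j};
          \<And>s i. \<lbrakk>\<bar>s\<bar> \<le> int N; i < 3\<rbrakk> \<Longrightarrow> q \<noteq> ?P j s i\<rbrakk> \<Longrightarrow> \<pi> j g q = (q + e) mod 2 ^ k j"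
    using word_normal_form[OF ss(1,2)] ss(1) unfolding ss(3)[symmetric] by force
  have gG: "g \<in> carrier G" using assms(1) word_ball_subset_carrier[of "{a, b}" N] by auto
  have "\<exists>j\<le>j0. \<pi> j g \<noteq> id"
  proof (rule ccontr)
    assume "\<not> (\<exists>j\<le>j0. \<pi> j g \<noteq> id)"
    then have triv: "\<pi> j0 g = id" "\<And>j. j \<le> j0 \<Longrightarrow> \<pi> j g = id" by auto
    \<comment> \<open>The point \<open>N + 1\<close> is moved by no conjugate of the 3-cycle occurring in the word, so the
      total shift has to vanish.\<close>
    have "int N + 1 \<noteq> ?P j0 s i" if s: "\<bar>s\<bar> \<le> int N" and i: "i < 3" for s i
    proof
      assume "int N + 1 = ?P j0 s i"
      moreover have "int N + 1 = pos (2 ^ (j0 + 1)) (2 ^ k j0) (int N + 1) 0"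
        using d_ge[of j0] assms(3) by (simp add: pos_def del: power_Suc)
      moreover have "\<bar>(int N + 1) - s\<bar> < 2 ^ (j0 + 1)"
      proof -
        have "int N < 2 ^ j0" using assms(3) by simp
        then show ?thesis using s power_Suc[of "2::int" j0] unfolding Suc_eq_plus1 by linarith
      qed
      ultimately show False
        using pos_eqD(1)[OF d_ge[of j0], of "int N + 1" s 0 i] s i by auto
    qed
    then have "int N + 1 = (int N + 1 + e) mod 2 ^ k j0"
      using off[OF assms(3), of "int N + 1"] triv(1) d_ge[of j0] assms(3)
      by (simp del: power_Suc)
    moreover have "(int N + 1 + e) mod 2 ^ k j0 = int N + 1 + e"
      using e d_ge[of j0] assms(3) by (intro mod_pos_pos_trivial; linarith)
    ultimately have e0: "e = 0" by simp
    have c0: "c s mod 3 = 0" if "\<bar>s\<bar> \<le> int N" for s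
    proof -
      have "?P j0 s 0 = ?P j0 s (c s mod 3)"
        using on[OF assms(3) that, of 0] triv(1) e0 by simp
      from pos_eqD(2)[OF d_ge[of j0] _ _ _ this] show ?thesis by simp
    qed
    have "\<pi> j g = id" for j
    proof (cases "j \<le> j0")
      case False
      have j: "2 * int N < 2 ^ (j + 1)"
      proof -
        have "(2::int) ^ (j0 + 1) \<le> 2 ^ (j + 1)" using False by (intro power_increasing) auto
        then show ?thesis using assms(3) by linarith
      qed
      show ?thesis
      proof
        fix q
        show "\<pi> j g q = id q"
        proof (cases "q \<in> {0..<2 ^ k j}")
          case True
          show ?thesis
          proof (cases "\<exists>s i. \<bar>s\<bar> \<le> int N \<and> i < 3 \<and> q = ?P j s i")
            case True
            then obtain s i where si: "\<bar>s\<bar> \<le> int N" "i < 3" "q = ?P j s i" by blast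
            have "(i + c s) mod 3 = i" using c0[OF si(1)] si(2) by presburger
            then show ?thesis using on[OF j si(1,2)] si(3) e0 by simp
          next
            case False
            then show ?thesis using off[OF j True] True e0 by fastforce
          qed
        next
          case False
          then show ?thesis using permutes_not_in[OF \<pi>_permutes[OF gG]] by simp
        qed
      qed
    qed (use triv in simp)
    then show False using faithful gG assms(2) by blast
  qed
  then show ?thesis using that by blast
qed

section \<open>Images of subgroups in one factor\<close>

lemma perm_group_on_image:
  assumes "subgroup H G"
  shows "perm_group_on {0..<2 ^ k j} (\<pi> j ` H)"
proof
  have HG: "H \<subseteq> carrier G" using subgroup.subset[OF assms] .
  show "p permutes {0..<2 ^ k j}" if "p \<in> \<pi> j ` H" for p
    using that HG \<pi>_permutes by auto
  show "p \<circ> q \<in> \<pi> j ` H" if pq: "p \<in> \<pi> j ` H" "q \<in> \<pi> j ` H" for p q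
  proof -
    obtain g h where gh: "g \<in> H" "h \<in> H" "p = \<pi> j g" "q = \<pi> j h" using pq by blast
    then have "p \<circ> q = \<pi> j (g \<otimes> h)" using \<pi>_mult[of g h j] subsetD[OF HG] by simp
    then show ?thesis using subgroup.m_closed[OF assms] gh by blast
  qed
  show "inv_into UNIV p \<in> \<pi> j ` H" if p: "p \<in> \<pi> j ` H" for p
  proof -
    obtain g where g: "g \<in> H" "p = \<pi> j g" using p by blast
    then have "inv_into UNIV p = \<pi> j (inv\<^bsub>G\<^esub> g)" using \<pi>_inv HG by auto
    then show ?thesis using subgroup.m_inv_closed[OF assms] g by blast
  qed
qed

text \<open>Conjugating \<open>b\<close> by powers of \<open>a\<close> gives the translate of its
  3-cycle through every residue. The offset \<open>2 * x + 1\<close> is odd, hence generates the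
  residues modulo the power of two \<open>d\<close>, so these translates connect all points.\<close>

lemma image_contains_cyc3: "contains_cyc3 {0..<2 ^ k j} (\<pi> j ` carrier G)"
proof -
  define x d :: int where "x = 2 ^ (j + 1)" and "d = 2 ^ k j"
  have x: "0 < x" and d: "8 * x \<le> d" and d0: "0 < d"
    using d_ge[of j] unfolding x_def d_def by auto
  interpret perm_group_on "{0..<d}" "\<pi> j ` carrier G"
    unfolding d_def by (rule perm_group_on_image[OF subgroup_self])
  have b: "\<pi> j b = cyc3 0 x (2 * x + 1)" unfolding x_def by (rule \<pi>_b)
  have "contains_cyc3 {0..<d} (\<pi> j ` carrier G)"
  proof (rule contains_cyc3_if_connected[of 0 x "2 * x + 1"
        "\<lambda>u. (u + x) mod d" "\<lambda>u. (u + (2 * x + 1)) mod d"])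
    show "finite {0..<d}" by simp
    show "{0, x, 2 * x + 1} \<subseteq> {0..<d}" "distinct [0, x, 2 * x + 1]" using x d by auto
    show "cyc3 0 x (2 * x + 1) \<in> \<pi> j ` carrier G" using b b_closed by (metis imageI)
  next
    fix u assume u: "u \<in> {0..<d}"
    have P: "pos x d u 0 = u" "pos x d u (Suc 0) = (u + x) mod d" "pos x d u 2 = (u + (2 * x + 1)) mod d"
      using u by (simp_all add: pos_def)
    have ne: "pos x d u i \<noteq> pos x d u i'" if "i < 3" "i' < 3" "i \<noteq> i'" for i i'
      using pos_eqD(2)[OF d, of u u i i'] x that by auto
    have "distinct [u, (u + x) mod d, (u + (2 * x + 1)) mod d]"
      using ne[of 0 "Suc 0"] ne[of 0 2] ne[of "Suc 0" 2] unfolding P by auto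
    moreover have "cyc3 u ((u + x) mod d) ((u + (2 * x + 1)) mod d) \<in> \<pi> j ` carrier G"
    proof -
      have "\<pi> j (a [^] nat u) = shift d u" using u \<pi>_pow_a[of j "nat u"] by (simp add: d_def)
      then have sh: "shift d u \<in> \<pi> j ` carrier G" by (metis a_closed imageI nat_pow_closed)
      have "cyc3 0 x (2 * x + 1) \<in> \<pi> j ` carrier G" using b b_closed by (metis imageI)
      from cyc3_conj_in[OF sh this] show ?thesis
        using x d u by (simp add: shift_def add.commute)
    qed
    ultimately show "(u + x) mod d \<in> {0..<d} \<and> (u + (2 * x + 1)) mod d \<in> {0..<d} \<and>
        distinct [u, (u + x) mod d, (u + (2 * x + 1)) mod d] \<and>
        cyc3 u ((u + x) mod d) ((u + (2 * x + 1)) mod d) \<in> \<pi> j ` carrier G"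
      using d0 by simp
  next
    fix U assume zero: "0 \<in> U"
      and closed: "\<And>u. \<lbrakk>u \<in> U; u \<in> {0..<d}\<rbrakk> \<Longrightarrow> (u + (2 * x + 1)) mod d \<in> U"
    have mult: "(int m * (2 * x + 1)) mod d \<in> U" for m
    proof (induction m)
      case (Suc m)
      have "(int m * (2 * x + 1)) mod d \<in> {0..<d}" using d0 by simp
      from closed[OF Suc this]
      have "(int m * (2 * x + 1) + (2 * x + 1)) mod d \<in> U" by (simp only: mod_add_left_eq)
      moreover have "int m * (2 * x + 1) + (2 * x + 1) = int (Suc m) * (2 * x + 1)"
        by (simp add: algebra_simps)
      ultimately show ?case by metis
    qed (use zero in simp)
    have "coprime (2 * x + 1) d" unfolding d_def by simp
    then obtain u v where uv: "u * (2 * x + 1) + v * d = 1"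
      using bezout_int[of "2 * x + 1" d] by (auto simp: coprime_iff_gcd_eq_1)
    show "{0..<d} \<subseteq> U"
    proof
      fix q assume q: "q \<in> {0..<d}"
      \<comment> \<open>By the Bezout identity \<open>u\<close> inverts \<open>2 * x + 1\<close>
        modulo \<open>d\<close>, so \<open>m\<close> steps lead from 0 to \<open>q\<close>.\<close>
      define m where "m = nat ((q * u) mod d)"
      have m: "int m = (q * u) mod d" using d0 by (simp add: m_def)
      have "(int m * (2 * x + 1)) mod d = (q * u * (2 * x + 1)) mod d"
        unfolding m by (rule mod_mult_left_eq)
      also have "q * u * (2 * x + 1) = q * (u * (2 * x + 1))" by (rule mult.assoc)
      also have "u * (2 * x + 1) = 1 - v * d" using uv by linarith
      also have "q * (1 - v * d) = q + (- (q * v)) * d" by (simp add: algebra_simps)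
      also have "\<dots> mod d = q" using q by (subst mod_mult_self1) simp
      finally show "q \<in> U" using mult[of m] by simp
    qed
  qed
  then show ?thesis unfolding d_def .
qed

text \<open>The intersection of \<open>G\<close> with the \<open>i\<close>-th factor of the product;
  \<open>\<pi> i\<close> is injective on it.\<close>

definition support_only :: "nat \<Rightarrow> 'a set" where
  "support_only i = {g \<in> carrier G. \<forall>j. j \<noteq> i \<longrightarrow> \<pi> j g = id}"

lemma support_only_normal: "support_only i \<lhd> G"
proof (rule normal_invI)
  show "subgroup (support_only i) G"
  proof (rule subgroupI)
    show "support_only i \<subseteq> carrier G" "support_only i \<noteq> {}"
      using \<pi>_one unfolding support_only_def by auto
    show "inv\<^bsub>G\<^esub> g \<in> support_only i" if "g \<in> support_only i" for g
      using that unfolding support_only_def by (auto simp: \<pi>_inv)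
    show "g \<otimes> h \<in> support_only i" if "g \<in> support_only i" "h \<in> support_only i" for g h
      using that unfolding support_only_def by (auto simp: \<pi>_mult)
  qed
  show "h \<otimes> g \<otimes> inv\<^bsub>G\<^esub> h \<in> support_only i" if "h \<in> carrier G" "g \<in> support_only i" for g h
    using that \<pi>_mult[of h "inv\<^bsub>G\<^esub> h"] \<pi>_one unfolding support_only_def by (auto simp: \<pi>_mult)
qed

lemma support_only_eqI:
  assumes "g \<in> support_only i" "h \<in> support_only i" "\<pi> i g = \<pi> i h"
  shows "g = h"
proof -
  have G: "g \<in> carrier G" "h \<in> carrier G" using assms unfolding support_only_def by auto
  have "\<pi> j g = \<pi> j h" for j
    using assms unfolding support_only_def by (cases "j = i") auto
  then have "\<pi> j (g \<otimes> inv\<^bsub>G\<^esub> h) = id" for j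
    using \<pi>_mult[of h "inv\<^bsub>G\<^esub> h" j] G \<pi>_one by (simp add: \<pi>_mult)
  then have "g \<otimes> inv\<^bsub>G\<^esub> h = \<one>" using faithful G by simp
  then show ?thesis using G by (metis inv_equality inv_inv inv_closed)
qed

lemma support_only_\<pi>_ne_id:
  "\<lbrakk>g \<in> support_only i; g \<noteq> \<one>\<rbrakk> \<Longrightarrow> \<pi> i g \<noteq> id"
  using support_only_eqI[of g i \<one>] \<pi>_one unfolding support_only_def by auto

text \<open>The image of \<open>M\<close> is nontrivial and normalised by the image of
  \<open>G\<close>, which contains all 3-cycles, so the criterion for normalised permutation groups
  applies.\<close>

lemma normal_contains_cyc3:
  assumes M: "M \<lhd> G" and "M \<subseteq> support_only i" "h \<in> M" "h \<noteq> \<one>"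
  shows "contains_cyc3 {0..<2 ^ k i} (\<pi> i ` M)"
proof -
  interpret perm_group_on "{0..<2 ^ k i}" "\<pi> i ` M"
    by (rule perm_group_on_image[OF normal_imp_subgroup[OF M]])
  have MG: "M \<subseteq> carrier G" using assms(2) unfolding support_only_def by auto
  show ?thesis
  proof (rule contains_cyc3_if_normal[of "\<pi> i h"])
    have "(9::int) \<le> 2 ^ k i" using d_ge[of i] one_le_power[of "2::int" i] by (simp del: one_le_power)
    then have "nat 9 \<le> nat (2 ^ k i)" by (rule nat_mono)
    then show "9 \<le> card {0..<(2::int) ^ k i}" by simp
    show "\<pi> i h \<in> \<pi> i ` M" "\<pi> i h \<noteq> id"
      using support_only_\<pi>_ne_id assms by auto
    fix p and u v w :: int
    assume p: "p \<in> \<pi> i ` M" and uvw: "{u, v, w} \<subseteq> {0..<2 ^ k i}" "distinct [u, v, w]"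
    obtain m where m: "m \<in> M" "p = \<pi> i m" using p by blast
    obtain t where t: "t \<in> carrier G" "cyc3 u v w = \<pi> i t"
      using image_contains_cyc3[of i] uvw unfolding contains_cyc3_def by blast
    have "cyc3 u v w \<circ> p \<circ> cyc3 w v u = \<pi> i (t \<otimes> m \<otimes> inv\<^bsub>G\<^esub> t)"
      using m t MG inv_cyc3[OF uvw(2)] by (auto simp: \<pi>_mult \<pi>_inv)
    moreover have "t \<otimes> m \<otimes> inv\<^bsub>G\<^esub> t \<in> M" using normal.inv_op_closed2[OF M] m t by blast
    ultimately show "cyc3 u v w \<circ> p \<circ> cyc3 w v u \<in> \<pi> i ` M" by blast
  qed simp
qed

section \<open>Short commutators supported in a single factor\<close>

definition shifted_b :: "nat \<Rightarrow> 'a" where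
  "shifted_b i = a [^] (2 ^ (i + 1) :: nat) \<otimes> b \<otimes> inv\<^bsub>G\<^esub> (a [^] (2 ^ (i + 1) :: nat))"

text \<open>The commutator of \<open>b\<close> and \<open>shifted_b i\<close>. In factor
  \<open>i\<close> the exponent of \<open>a\<close> is the distance between the first two points of
  the 3-cycle, so the 3-cycle and its shift share exactly one point; in the other factors they
  commute.\<close>

definition witness :: "nat \<Rightarrow> 'a" where
  "witness i = (b \<otimes> shifted_b i) \<otimes> inv\<^bsub>G\<^esub> (shifted_b i \<otimes> b)"

lemma shifted_b_closed [simp]: "shifted_b i \<in> carrier G"
  unfolding shifted_b_def by simp

lemma witness_closed [simp]: "witness i \<in> carrier G"
  unfolding witness_def by simp

lemma witness_eq_one_iff: "witness i = \<one> \<longleftrightarrow> b \<otimes> shifted_b i = shifted_b i \<otimes> b"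
  unfolding witness_def
  by (metis b_closed inv_closed inv_equality inv_inv m_closed r_inv shifted_b_closed)

lemma \<pi>_shifted_b:
  "\<pi> j (shifted_b i) = cyc3 (pos (2 ^ (j + 1)) (2 ^ k j) (2 ^ (i + 1)) 0)
     (pos (2 ^ (j + 1)) (2 ^ k j) (2 ^ (i + 1)) (Suc 0)) (pos (2 ^ (j + 1)) (2 ^ k j) (2 ^ (i + 1)) 2)"
proof -
  define x d :: int where "x = 2 ^ (j + 1)" and "d = 2 ^ k j"
  have x: "0 < x" and d: "8 * x \<le> d" and d0: "0 < d"
    using d_ge[of j] unfolding x_def d_def by auto
  let ?s = "a [^] (2 ^ (i + 1) :: nat)"
  have s: "\<pi> j ?s = shift d (2 ^ (i + 1))" using \<pi>_pow_a[of j "2 ^ (i + 1)"] by (simp add: d_def)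
  have b: "\<pi> j b = cyc3 (pos x d 0 0) (pos x d 0 (Suc 0)) (pos x d 0 2)"
    unfolding pos_zero[OF x d] unfolding x_def by (rule \<pi>_b)
  have "\<pi> j (shifted_b i) = \<pi> j ?s \<circ> \<pi> j b \<circ> \<pi> j (inv\<^bsub>G\<^esub> ?s)"
    unfolding shifted_b_def by (simp add: \<pi>_mult)
  also have "\<pi> j ?s \<circ> \<pi> j b = cyc3 (\<pi> j ?s (pos x d 0 0)) (\<pi> j ?s (pos x d 0 (Suc 0))) (\<pi> j ?s (pos x d 0 2)) \<circ> \<pi> j ?s"
    unfolding b by (rule comp_cyc3) (use \<pi>_bij[of ?s j] bij_is_inj in simp)
  also have "\<dots> \<circ> \<pi> j (inv\<^bsub>G\<^esub> ?s) = cyc3 (\<pi> j ?s (pos x d 0 0)) (\<pi> j ?s (pos x d 0 (Suc 0))) (\<pi> j ?s (pos x d 0 2)) \<circ> (\<pi> j (?s \<otimes> inv\<^bsub>G\<^esub> ?s))"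
    by (subst \<pi>_mult) (simp_all add: comp_assoc)
  also have "\<dots> = cyc3 (pos x d (2 ^ (i + 1)) 0) (pos x d (2 ^ (i + 1)) (Suc 0)) (pos x d (2 ^ (i + 1)) 2)"
    using \<pi>_one s by (simp add: shift_pos[OF d0])
  finally show ?thesis unfolding x_def d_def .
qed

text \<open>For \<open>j \<noteq> i\<close> the shift \<open>2^(i + 1)\<close> is either zero modulo the power of two \<open>d = 2^(k j)\<close> or not
  congruent to \<open>\<plusminus> 2^(j + 1)\<close>, and the remaining differences of the points of the 3-cycle are odd. So
  the 3-cycle and its shift are equal or disjoint.\<close>

lemma witness_support: "witness i \<in> support_only i"
proof -
  have "\<pi> j (witness i) = id" if ij: "j \<noteq> i" for j
  proof -
    define x d r :: int where "x = 2 ^ (j + 1)" and "d = 2 ^ k j" and "r = 2 ^ (i + 1)"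
    have x: "0 < x" and d: "8 * x \<le> d" and d0: "0 < d"
      using d_ge[of j] unfolding x_def d_def by auto
    have even: "even x" "even d" "even r"
      using k_ge[of j] unfolding x_def d_def r_def by auto
    have b: "\<pi> j b = cyc3 (pos x d 0 0) (pos x d 0 (Suc 0)) (pos x d 0 2)"
      unfolding pos_zero[OF x d] unfolding x_def by (rule \<pi>_b)
    have c: "\<pi> j (shifted_b i) = cyc3 (pos x d r 0) (pos x d r (Suc 0)) (pos x d r 2)"
      unfolding x_def d_def r_def by (rule \<pi>_shifted_b)
    have "\<pi> j b \<circ> \<pi> j (shifted_b i) = \<pi> j (shifted_b i) \<circ> \<pi> j b"
    proof (cases "d dvd r")
      case True
      then have "(r + z) mod d = (0 + z) mod d" for z
        by (metis add.commute add_0 dvd_imp_mod_0 mod_add_right_eq)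
      then have "pos x d r m = pos x d 0 m" for m unfolding pos_def by blast
      then show ?thesis unfolding b c by simp
    next
      case False
      have add: "\<not> d dvd r + x" and sub: "\<not> d dvd r - x"
        using not_power_of_two_dvd[of i j "k j" x] not_power_of_two_dvd[of i j "k j" "- x"] k_ge[of j] ij unfolding d_def r_def x_def by auto
      have ne: "pos x d r m \<noteq> pos x d 0 m'" if "m < 3" "m' < 3" for m m'
      proof
        assume "pos x d r m = pos x d 0 m'"
        then have dvd: "d dvd (r + (if m = 0 then 0 else if m = 1 then x else 2 * x + 1)) -
            (0 + (if m' = 0 then 0 else if m' = 1 then x else 2 * x + 1))"
          unfolding pos_def mod_eq_dvd_iff .
        then have "even (r + (if m = 0 then 0 else if m = 1 then x else 2 * x + 1) -
            (0 + (if m' = 0 then 0 else if m' = 1 then x else 2 * x + 1)))"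
          using even(2) dvd_trans by blast
        then have "m = m' \<or> m = 0 \<and> m' = 1 \<or> m = 1 \<and> m' = 0"
          using even that by (auto split: if_splits)
        then show False using dvd False add sub by auto
      qed
      show ?thesis unfolding b c by (rule cyc3_commute) (use ne in auto)
    qed
    then have "\<pi> j (b \<otimes> shifted_b i) = \<pi> j (shifted_b i \<otimes> b)" by (simp add: \<pi>_mult)
    then have "\<pi> j (witness i) = \<pi> j ((shifted_b i \<otimes> b) \<otimes> inv\<^bsub>G\<^esub> (shifted_b i \<otimes> b))"
      unfolding witness_def by (subst (1 2) \<pi>_mult) auto
    then show ?thesis using \<pi>_one by simp
  qed
  then show ?thesis unfolding support_only_def by simp
qed

text \<open>In factor \<open>i\<close>, applying \<open>shifted_b i\<close> and then
  \<open>b\<close> sends 0 to \<open>x\<close>, while the other order sends it to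
  \<open>2 * x\<close>.\<close>

lemma witness_ne_one: "witness i \<noteq> \<one>"
proof
  assume "witness i = \<one>"
  then have "\<pi> i (b \<otimes> shifted_b i) 0 = \<pi> i (shifted_b i \<otimes> b) 0"
    using witness_eq_one_iff by simp
  moreover define x d :: int where "x = 2 ^ (i + 1)" and "d = 2 ^ k i"
  have x: "0 < x" and d: "8 * x \<le> d" using d_ge[of i] unfolding x_def d_def by auto
  have b: "\<pi> i b = cyc3 0 x (2 * x + 1)" unfolding x_def by (rule \<pi>_b)
  have "pos x d x 0 = x" "pos x d x (Suc 0) = 2 * x" "pos x d x 2 = 3 * x + 1"
    using x d by (simp_all add: pos_def)
  then have "\<pi> i (shifted_b i) = cyc3 x (2 * x) (3 * x + 1)"
    using \<pi>_shifted_b[of i i] unfolding x_def[symmetric] d_def[symmetric] by simp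
  ultimately show False using x by (simp add: \<pi>_mult b cyc3_def)
qed

lemma witness_in_word_ball: "witness i \<in> word_ball G {a, b} (12 * 2 ^ i)"
proof -
  have ab: "{a, b} \<subseteq> carrier G" by simp
  let ?r = "2 ^ (i + 1) :: nat"
  have A: "a \<in> word_ball G {a, b} 1" and B: "b \<in> word_ball G {a, b} 1"
    by (rule word_ball_letter[OF ab]; simp)+
  have P: "a [^] ?r \<in> word_ball G {a, b} ?r" using word_ball_pow[OF ab A, of ?r] by simp
  have C: "shifted_b i \<in> word_ball G {a, b} (?r + 1 + ?r)"
    unfolding shifted_b_def using word_ball_mult[OF ab word_ball_mult[OF ab P B] word_ball_inv[OF ab P]] .
  have "witness i \<in> word_ball G {a, b} ((1 + (?r + 1 + ?r)) + ((?r + 1 + ?r) + 1))"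
    unfolding witness_def
    using word_ball_mult[OF ab word_ball_mult[OF ab B C] word_ball_inv[OF ab word_ball_mult[OF ab C B]]] .
  \<comment> \<open>The left side is \<open>4 * ?r + 4\<close>, that is
    \<open>8 * 2 ^ i + 4\<close>.\<close>
  moreover have "(1 + (?r + 1 + ?r)) + ((?r + 1 + ?r) + 1) \<le> 12 * 2 ^ i"
    using one_le_power[of "2::nat" i] by simp
  ultimately show ?thesis using word_ball_mono by blast
qed

section \<open>Bounds for normal depth and for the growth function\<close>

lemma exists_normal_subgroup:
  assumes "g \<in> carrier G" "\<pi> j g \<noteq> id"
  shows "\<exists>N. N \<lhd> G \<and> finite_index G N \<and> g \<notin> N \<and> card (rcosets N) \<le> fact (2 ^ k j)"
proof -
  \<comment> \<open>The cosets of the kernel of \<open>\<pi> j\<close> are fibres of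
    \<open>\<pi> j\<close>, so there are at most as many as permutations of the
    \<open>2 ^ k j\<close> points.\<close>
  define N where "N = {h \<in> carrier G. \<pi> j h = id}"
  have sub: "subgroup N G"
    by (rule subgroupI) (auto simp: N_def \<pi>_one \<pi>_inv \<pi>_mult intro: exI[of _ \<one>])
  have "N \<lhd> G" unfolding normal_inv_iff
  proof (intro conjI ballI sub)
    fix h m assume "h \<in> carrier G" "m \<in> N"
    then show "h \<otimes> m \<otimes> inv\<^bsub>G\<^esub> h \<in> N"
      using \<pi>_mult[of h "inv\<^bsub>G\<^esub> h" j] \<pi>_one by (simp add: N_def \<pi>_mult)
  qed
  have coset: "N #> h = {m \<in> carrier G. \<pi> j m = \<pi> j h}" if h: "h \<in> carrier G" for h
  proof (intro equalityI subsetI)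
    fix m assume "m \<in> N #> h"
    then show "m \<in> {m \<in> carrier G. \<pi> j m = \<pi> j h}"
      using h by (auto simp: r_coset_def N_def \<pi>_mult)
  next
    fix m assume m: "m \<in> {m \<in> carrier G. \<pi> j m = \<pi> j h}"
    then have "\<pi> j (m \<otimes> inv\<^bsub>G\<^esub> h) = id"
      using h \<pi>_mult[of h "inv\<^bsub>G\<^esub> h" j] \<pi>_one by (simp add: \<pi>_mult)
    then have "m \<otimes> inv\<^bsub>G\<^esub> h \<in> N" using m h by (simp add: N_def)
    moreover have "m = m \<otimes> inv\<^bsub>G\<^esub> h \<otimes> h" using m h by (simp add: m_assoc)
    ultimately show "m \<in> N #> h" unfolding r_coset_def by blast
  qed
  let ?P = "{p. p permutes {0..<(2::int) ^ k j}}"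
  have finP: "finite ?P" by (simp add: finite_permutations)
  have "rcosets N \<subseteq> (\<lambda>p. {m \<in> carrier G. \<pi> j m = p}) ` ?P"
    using coset \<pi>_permutes unfolding RCOSETS_def by auto
  then have "finite (rcosets N)" "card (rcosets N) \<le> card ?P"
    using finP by (auto intro: finite_subset surj_card_le)
  moreover have "card ?P = fact (2 ^ k j)"
    using card_permutations[of "{0..<(2::int) ^ k j}" "2 ^ k j"] by (simp add: nat_power_eq)
  ultimately show ?thesis
    using \<open>N \<lhd> G\<close> assms unfolding finite_index_def by (intro exI[of _ N]) (auto simp: N_def)
qed

text \<open>If \<open>N\<close> met \<open>support_only i\<close> nontrivially, the image of the
  intersection would contain all 3-cycles, which forces the witness into \<open>N\<close>. So
  \<open>support_only i\<close> embeds into the quotient by \<open>N\<close>, and its image under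
  \<open>\<pi> i\<close> has at least half as many elements as the symmetric group.\<close>

lemma fact_le_card_rcosets:
  assumes N: "N \<lhd> G" "finite_index G N" and "witness i \<notin> N"
  shows "fact (2 ^ k i) \<le> 2 * card (rcosets N)"
proof -
  let ?K = "support_only i"
  have sN: "subgroup N G" using normal_imp_subgroup[OF N(1)] .
  have sK: "subgroup ?K G" using normal_imp_subgroup[OF support_only_normal] .
  define x d :: int where "x = 2 ^ (i + 1)" and "d = 2 ^ k i"
  have x: "0 < x" and d: "8 * x \<le> d" and d0: "0 < d"
    using d_ge[of i] unfolding x_def d_def by auto
  interpret KQ: perm_group_on "{0..<d}" "\<pi> i ` ?K"
    unfolding d_def by (rule perm_group_on_image[OF sK])
  have K3: "contains_cyc3 {0..<d} (\<pi> i ` ?K)"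
    unfolding d_def
    using normal_contains_cyc3[OF support_only_normal _ witness_support witness_ne_one] by blast
  have triv: "h = \<one>" if h: "h \<in> N \<inter> ?K" for h
  proof (rule ccontr)
    assume ne: "h \<noteq> \<one>"
    have M: "N \<inter> ?K \<lhd> G"
      using normal_subgroup_intersect[OF N(1) support_only_normal] .
    have c3: "contains_cyc3 {0..<d} (\<pi> i ` (N \<inter> ?K))"
      unfolding d_def by (rule normal_contains_cyc3[OF M _ h ne]) auto
    have "cyc3 0 x (2 * x + 1) \<in> \<pi> i ` (N \<inter> ?K)"
      by (rule contains_cyc3D[OF c3]) (use x d in auto)
    then have b: "\<pi> i b \<in> \<pi> i ` (N \<inter> ?K)" unfolding x_def by (simp add: \<pi>_b)
    then obtain m where m: "m \<in> N \<inter> ?K" "\<pi> i b = \<pi> i m" by blast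
    let ?s = "shifted_b i"
    have mG: "m \<in> carrier G" using m sN subgroup.subset by blast
    \<comment> \<open>This is the commutator of \<open>m\<close> with \<open>shifted_b i\<close>. It
      has the same image as the witness in factor \<open>i\<close> because \<open>m\<close> acts
      there like \<open>b\<close>, and unlike \<open>b\<close> the element \<open>m\<close> belongs
      to \<open>N \<inter> ?K\<close>.\<close>
    define m' where "m' = m \<otimes> (?s \<otimes> inv\<^bsub>G\<^esub> m \<otimes> inv\<^bsub>G\<^esub> ?s)"
    have "?s \<otimes> inv\<^bsub>G\<^esub> m \<otimes> inv\<^bsub>G\<^esub> ?s \<in> N \<inter> ?K"
      using normal.inv_op_closed2[OF M shifted_b_closed] m
        subgroup.m_inv_closed[OF normal_imp_subgroup[OF M]] by blast
    then have m': "m' \<in> N \<inter> ?K"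
      unfolding m'_def using m subgroup.m_closed[OF normal_imp_subgroup[OF M]] by blast
    have inv: "\<pi> i (inv\<^bsub>G\<^esub> b) = \<pi> i (inv\<^bsub>G\<^esub> m)" using m mG by (simp add: \<pi>_inv)
    have "witness i = b \<otimes> (?s \<otimes> inv\<^bsub>G\<^esub> b \<otimes> inv\<^bsub>G\<^esub> ?s)"
      unfolding witness_def by (simp add: inv_mult_group m_assoc)
    then have "\<pi> i (witness i) = \<pi> i m'"
      unfolding m'_def using mG m(2) inv by (simp add: \<pi>_mult)
    then have "witness i = m'" using support_only_eqI[OF witness_support] m' by blast
    then show False using m' assms(3) by blast
  qed
  have "fact (card {0..<d}) \<le> 2 * card (\<pi> i ` ?K)"
  proof (rule KQ.fact_card_le[OF _ K3, of 0 x])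
    show "id \<in> \<pi> i ` ?K"
      using KQ.id_in[OF contains_cyc3D[OF K3, of 0 x "2 * x + 1"]] x d by auto
  qed (use x d in auto)
  also have "card {0..<d} = 2 ^ k i" unfolding d_def by (simp add: nat_power_eq)
  also have "card (\<pi> i ` ?K) \<le> card (rcosets N)"
  proof -
    have fin: "finite (rcosets N)" using N(2) unfolding finite_index_def .
    have KG: "?K \<subseteq> carrier G" unfolding support_only_def by auto
    have inj: "inj_on (\<lambda>g. N #> g) ?K"
    proof (rule inj_onI)
      fix g h assume gh: "g \<in> ?K" "h \<in> ?K" "N #> g = N #> h"
      have G: "g \<in> carrier G" "h \<in> carrier G" using gh KG by auto
      have "g \<in> N #> h" using gh(3) rcos_self[OF G(1) sN] by simp
      then obtain n where n: "n \<in> N" "g = n \<otimes> h" unfolding r_coset_def by blast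
      have nG: "n \<in> carrier G" using n sN subgroup.subset by blast
      have "n = g \<otimes> inv\<^bsub>G\<^esub> h" using n nG G by (simp add: m_assoc)
      then have "n \<in> N \<inter> ?K"
        using n subgroup.m_closed[OF sK gh(1) subgroup.m_inv_closed[OF sK gh(2)]] by simp
      then have "n = \<one>" by (rule triv)
      then show "g = h" using n G by simp
    qed
    have sub: "(\<lambda>g. N #> g) ` ?K \<subseteq> rcosets N" using KG unfolding RCOSETS_def by auto
    have "finite ?K" using finite_imageD[OF finite_subset[OF sub fin] inj] .
    then have "card (\<pi> i ` ?K) \<le> card ?K" by (rule card_image_le)
    also have "\<dots> \<le> card (rcosets N)" using card_inj_on_le[OF inj sub fin] .
    finally show ?thesis .
  qed
  finally show ?thesis by simp
qed

lemma residually_finite_G: "residually_finite G"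
  unfolding residually_finite_def
proof
  fix g assume g: "g \<in> carrier G - {\<one>}"
  then obtain j where "\<pi> j g \<noteq> id" using faithful by blast
  then show "\<exists>H. subgroup H G \<and> finite_index G H \<and> g \<notin> H"
    using exists_normal_subgroup[of g j] g normal_imp_subgroup by blast
qed

lemma normal_depth_le:
  assumes "g \<in> carrier G" "\<pi> j g \<noteq> id"
  shows "normal_depth G g \<le> fact (2 ^ k j)"
proof -
  obtain N where N: "N \<lhd> G" "finite_index G N" "g \<notin> N" "card (rcosets N) \<le> fact (2 ^ k j)"
    using exists_normal_subgroup[OF assms] by blast
  have "normal_depth G g \<le> card (rcosets N)"
    unfolding normal_depth_def by (rule Least_le) (use N in blast)
  then show ?thesis using N(4) by linarith
qed

lemma fact_le_normal_depth: "fact (2 ^ k i) \<le> 2 * normal_depth G (witness i)"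
proof -
  \<comment> \<open>Some index has to exist, for otherwise \<open>LEAST\<close> is
    unspecified.\<close>
  have "\<exists>c N. N \<lhd> G \<and> finite_index G N \<and> witness i \<notin> N \<and> c = card (rcosets N)"
    using exists_normal_subgroup[OF witness_closed support_only_\<pi>_ne_id[OF witness_support witness_ne_one]]
    by blast
  from LeastI_ex[OF this] show ?thesis
    unfolding normal_depth_def using fact_le_card_rcosets by metis
qed

text \<open>From below, the ball contains a witness whose index \<open>i\<close> has
  \<open>2 ^ i\<close> of order \<open>n\<close>. From above, every nontrivial element of the ball
  is visible in a factor with \<open>2 ^ j\<close> of order at most \<open>n\<close>, and the
  symmetric group there bounds its depth.\<close>

lemma rf_growth_bounds:
  fixes F :: "nat \<Rightarrow> nat" and A n :: nat
  assumes mono: "mono_on {1..} F" and A: "1 \<le> A" and n: "1 \<le> n"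
    and lower: "\<And>j. 2 * F (2 ^ j) \<le> fact (2 ^ k j)"
    and upper: "\<And>j. fact (2 ^ k j) \<le> F (A * 2 ^ j)"
  defines "S \<equiv> {a, b, witness 0}"
  shows "at_real F (1 / 24 * real n) \<le> rf_growth G S n"
    and "rf_growth G S n \<le> at_real F (real (24 * A) * real n)"
proof -
  have ab: "{a, b} \<subseteq> carrier G" by simp
  have SG: "S \<subseteq> carrier G" unfolding S_def by simp
  let ?D = "normal_depth G ` (word_ball G S n - {\<one>})"
  have fin: "finite ?D" using finite_word_ball[of S n] unfolding S_def by simp
  have mem: "normal_depth G (witness i) \<in> ?D" if "witness i \<in> word_ball G S n" for i
    using that witness_ne_one by blast
  have w0: "witness 0 \<in> word_ball G S n"
    using word_ball_letter[OF SG, of "witness 0"] word_ball_mono[OF n, of S] unfolding S_def by auto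
  have depth: "F (2 ^ i) \<le> rf_growth G S n" if "witness i \<in> word_ball G S n" for i
  proof -
    have "2 * F (2 ^ i) \<le> 2 * normal_depth G (witness i)"
      using lower[of i] fact_le_normal_depth[of i] by linarith
    also have "normal_depth G (witness i) \<le> rf_growth G S n"
      unfolding rf_growth_def by (rule Max_ge[OF fin mem[OF that]])
    finally show ?thesis by simp
  qed
  obtain i where i: "nat \<lceil>1 / 24 * real n\<rceil> \<le> 2 ^ i" "witness i \<in> word_ball G S n"
  proof (cases "n < 12")
    case True
    \<comment> \<open>For \<open>n < 12\<close> the argument of \<open>F\<close> rounds up to 1, and
      the generator \<open>witness 0\<close> serves.\<close>
    then have "nat \<lceil>1 / 24 * real n\<rceil> \<le> 2 ^ 0" by simp
    then show ?thesis using that w0 by blast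
  next
    case False
    then have "1 \<le> n div 12" by simp
    \<comment> \<open>The largest \<open>i\<close> for which \<open>12 * 2 ^ i\<close> is at most
      \<open>n\<close>; then \<open>n < 24 * 2 ^ i\<close>, which gives the constant
      \<open>1 / 24\<close>.\<close>
    then obtain i where i: "2 ^ i \<le> n div 12" "n div 12 < 2 ^ (i + 1)"
      using ex_power_ivl1[of 2 "n div 12"] by auto
    have "n \<le> 24 * 2 ^ i" using i(2) by simp
    then have "1 / 24 * real n \<le> real (2 ^ i)" by (simp flip: of_nat_le_iff[where 'a = real])
    then have "nat \<lceil>1 / 24 * real n\<rceil> \<le> 2 ^ i" by linarith
    moreover have "12 * 2 ^ i \<le> n" using i(1) by linarith
    then have "witness i \<in> word_ball G {a, b} n"
      using witness_in_word_ball[of i] word_ball_mono by blast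
    then have "witness i \<in> word_ball G S n" unfolding word_ball_def S_def by blast
    ultimately show ?thesis using that by blast
  qed
  have "1 \<le> nat \<lceil>1 / 24 * real n\<rceil>" using n by linarith
  then have "at_real F (1 / 24 * real n) \<le> F (2 ^ i)"
    unfolding at_real_def using mono_onD[OF mono] i(1) by simp
  then show "at_real F (1 / 24 * real n) \<le> rf_growth G S n"
    using depth[OF i(2)] by linarith
  have S12: "S \<subseteq> word_ball G {a, b} 12"
    using witness_in_word_ball[of 0] word_ball_letter[OF ab] word_ball_mono[of 1 12 "{a, b}"]
    unfolding S_def by auto
  have "1 \<le> 12 * n" using n by simp
  \<comment> \<open>Detecting words of length \<open>12 * n\<close> at index \<open>j0 + 1\<close>
    requires \<open>24 * n < 2 ^ (j0 + 2)\<close>, while \<open>2 ^ (j0 + 1) \<le> 24 * n\<close>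
    yields the constant \<open>24 * A\<close>.\<close>
  then obtain j0 where j0: "2 ^ j0 \<le> 12 * n" "12 * n < 2 ^ (j0 + 1)"
    using ex_power_ivl1[of 2 "12 * n"] by auto
  have "2 * int (12 * n) < int (2 ^ ((j0 + 1) + 1))" using j0(2) by (simp del: of_nat_power)
  then have j0': "2 * int (12 * n) < 2 ^ ((j0 + 1) + 1)" by simp
  have "normal_depth G g \<le> F (24 * A * n)" if g: "g \<in> word_ball G S n" "g \<noteq> \<one>" for g
  proof -
    have gb: "g \<in> word_ball G {a, b} (12 * n)" using word_ball_subset_word_ball[OF ab S12] g by blast
    obtain j where j: "j \<le> j0 + 1" "\<pi> j g \<noteq> id"
      using detected_at_small_index[OF gb g(2) j0'] by blast
    have "normal_depth G g \<le> fact (2 ^ k j)"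
      using normal_depth_le[OF _ j(2)] word_ball_subset_carrier[OF SG] g by blast
    also have "\<dots> \<le> F (A * 2 ^ j)" by (rule upper)
    also have "\<dots> \<le> F (24 * A * n)"
    proof (rule mono_onD[OF mono])
      have "(2::nat) ^ j \<le> 2 ^ (j0 + 1)" using j(1) by (intro power_increasing) auto
      also have "\<dots> \<le> 24 * n" using j0(1) by simp
      finally show "A * 2 ^ j \<le> 24 * A * n" using mult_le_mono2[of "2 ^ j" "24 * n" A] by simp
    qed (use A n in auto)
    finally show ?thesis .
  qed
  then have "\<And>c. c \<in> ?D \<Longrightarrow> c \<le> F (24 * A * n)" by blast
  moreover have "?D \<noteq> {}" using mem[OF w0] by blast
  ultimately have "rf_growth G S n \<le> F (24 * A * n)"
    unfolding rf_growth_def using Max.boundedI[OF fin] by blast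
  then show "rf_growth G S n \<le> at_real F (real (24 * A) * real n)"
    unfolding at_real_def by (simp flip: of_nat_mult)
qed

end

section \<open>Existence of the group\<close>

lemma (in group) countable_generate:
  assumes "finite S" "S \<subseteq> carrier G"
  shows "countable (generate G S)"
proof -
  have "x \<in> (\<Union>n. word_ball G S n)" if "x \<in> generate G S" for x
    using that
  proof (induction rule: generate.induct)
    case one
    then show ?case using one_in_word_ball by blast
  next
    case (incl h)
    then show ?case using word_ball_letter[OF assms(2), of h] by blast
  next
    case (inv h)
    then show ?case using word_ball_letter[OF assms(2), of "inv\<^bsub>G\<^esub> h"] by blast
  next
    case (eng h1 h2)
    then show ?case using word_ball_mult[OF assms(2)] by blast
  qed
  then have "generate G S \<subseteq> (\<Union>n. word_ball G S n)" by blast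
  moreover have "countable (\<Union>n. word_ball G S n)"
    by (intro countable_UN countableI_type countable_finite finite_word_ball assms(1))
  ultimately show ?thesis by (rule countable_subset)
qed

text \<open>Transport of structure along an injection of the carrier, because the theorem asks for a
  group of type \<open>nat monoid\<close>.\<close>

lemma countable_group_iso_nat:
  fixes H :: "('a, 'b) monoid_scheme"
  assumes "group H" "countable (carrier H)"
  shows "\<exists>(G :: nat monoid) \<phi>. group G \<and> \<phi> \<in> iso G H"
proof -
  interpret H: group H by fact
  let ?C = "carrier H"
  obtain f :: "'a \<Rightarrow> nat" where f: "inj_on f ?C" using assms(2) unfolding countable_def by blast
  define g where "g = inv_into ?C f"
  have g: "g x \<in> ?C" "f (g x) = x" if "x \<in> f ` ?C" for x
    using that unfolding g_def by (simp_all add: inv_into_into f_inv_into_f)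
  have gf: "g (f x) = x" if "x \<in> ?C" for x using that f unfolding g_def by simp
  define G :: "nat monoid" where
    "G = \<lparr>carrier = f ` ?C, monoid.mult = (\<lambda>x y. f (g x \<otimes>\<^bsub>H\<^esub> g y)), one = f \<one>\<^bsub>H\<^esub>\<rparr>"
  have "group G"
  proof (rule groupI)
    fix x y z assume "x \<in> carrier G" "y \<in> carrier G" "z \<in> carrier G"
    then show "x \<otimes>\<^bsub>G\<^esub> y \<otimes>\<^bsub>G\<^esub> z = x \<otimes>\<^bsub>G\<^esub> (y \<otimes>\<^bsub>G\<^esub> z)"
      by (auto simp: G_def gf H.m_assoc)
  next
    fix x assume "x \<in> carrier G"
    then obtain h where h: "h \<in> ?C" "x = f h" unfolding G_def by auto
    then show "\<exists>y\<in>carrier G. y \<otimes>\<^bsub>G\<^esub> x = \<one>\<^bsub>G\<^esub>"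
      by (intro bexI[of _ "f (inv\<^bsub>H\<^esub> h)"]) (simp_all add: G_def gf)
  qed (auto simp: G_def gf)
  moreover have "bij_betw g (carrier G) ?C"
    by (rule bij_betw_byWitness[where f' = f]) (use g gf in \<open>auto simp: G_def\<close>)
  then have "g \<in> iso G H"
    unfolding iso_def hom_def using g gf by (auto simp: G_def)
  ultimately show ?thesis by blast
qed

section \<open>The model inside a product of symmetric groups\<close>

lemma shift_permutes: "0 < d \<Longrightarrow> shift d e permutes {0..<d}"
proof -
  assume d: "0 < d"
  have "bij (shift d e)"
    by (rule o_bij[of "shift d (- e)"]) (simp_all add: shift_comp_shift shift_zero)
  then show ?thesis unfolding permutes_def bij_iff by (auto simp: shift_def)
qed

text \<open>In the full product \<open>H\<close> of symmetric groups, \<open>\<alpha>\<close> and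
  \<open>\<beta>\<close> generate a countable subgroup. It is copied to the natural numbers,
  \<open>\<phi>\<close> maps the copy back, and the projections are the coordinates of
  \<open>\<phi> g\<close>.\<close>

lemma shift_cyc3_group_exists:
  assumes "\<And>j. j + 4 \<le> k j"
  shows "\<exists>(G :: nat monoid) a b \<pi>. shift_cyc3_group G a b k \<pi>"
proof -
  let ?S = "\<lambda>j. {0..<(2::int) ^ k j}"
  define H :: "(nat \<Rightarrow> int \<Rightarrow> int) monoid" where
    "H = \<lparr>carrier = {f. \<forall>j. f j permutes ?S j}, monoid.mult = (\<lambda>f g j. f j \<circ> g j), one = (\<lambda>j. id)\<rparr>"
  have "group H"
  proof (rule groupI)
    fix f g assume "f \<in> carrier H" "g \<in> carrier H"
    then show "f \<otimes>\<^bsub>H\<^esub> g \<in> carrier H" by (simp add: H_def permutes_compose)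
  next
    fix f assume "f \<in> carrier H"
    then have f: "f j permutes ?S j" for j by (simp add: H_def)
    then show "\<exists>g\<in>carrier H. g \<otimes>\<^bsub>H\<^esub> f = \<one>\<^bsub>H\<^esub>"
      using permutes_inv_o(2)[OF f] permutes_inv[OF f]
      by (intro bexI[of _ "\<lambda>j. inv_into UNIV (f j)"]) (simp_all add: H_def)
  qed (simp_all add: H_def comp_assoc permutes_id)
  then interpret H: group H .
  define \<alpha> \<beta> :: "nat \<Rightarrow> int \<Rightarrow> int" where "\<alpha> = (\<lambda>j. shift (2 ^ k j) 1)"
    and "\<beta> = (\<lambda>j. cyc3 0 (2 ^ (j + 1)) (2 * 2 ^ (j + 1) + 1))"
  have \<alpha>: "\<alpha> \<in> carrier H" by (simp add: H_def \<alpha>_def shift_permutes)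
  have "\<beta> j permutes ?S j" for j
  proof -
    have d: "8 * 2 ^ (j + 1) \<le> (2::int) ^ k j"
    proof -
      have "(2::int) ^ (j + 4) \<le> 2 ^ k j" using assms by (intro power_increasing) auto
      then show ?thesis by (simp add: power_add)
    qed
    have "{0, x, 2 * x + 1} \<subseteq> {0..<d} \<and> distinct [0, x, 2 * x + 1]"
      if "0 < x" "8 * x \<le> d" for x d :: int
      using that by auto
    from this[OF _ d] show ?thesis unfolding \<beta>_def by (intro cyc3_permutes) simp_all
  qed
  then have \<beta>: "\<beta> \<in> carrier H" by (simp add: H_def)
  have ab: "{\<alpha>, \<beta>} \<subseteq> carrier H" using \<alpha> \<beta> by simp
  have sub: "subgroup (generate H {\<alpha>, \<beta>}) H" using H.generate_is_subgroup[OF ab] .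
  let ?H = "H\<lparr>carrier := generate H {\<alpha>, \<beta>}\<rparr>"
  have gH: "group ?H" using subgroup.subgroup_is_group[OF sub \<open>group H\<close>] .
  moreover have "countable (carrier ?H)" using H.countable_generate[OF _ ab] by simp
  ultimately obtain G :: "nat monoid" and \<phi> where G: "group G" and \<phi>: "\<phi> \<in> iso G ?H"
    using countable_group_iso_nat by blast
  interpret G: group G by fact
  interpret \<phi>: group_hom G ?H \<phi>
    using G gH \<phi> unfolding group_hom_def group_hom_axioms_def iso_def by blast
  have inj: "inj_on \<phi> (carrier G)" and surj: "\<phi> ` carrier G = generate H {\<alpha>, \<beta>}"
    using \<phi> unfolding iso_def bij_betw_def by auto
  have gen_in: "\<alpha> \<in> generate H {\<alpha>, \<beta>}" "\<beta> \<in> generate H {\<alpha>, \<beta>}"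
    by (simp_all add: generate.incl)
  obtain a where a: "a \<in> carrier G" "\<phi> a = \<alpha>" using gen_in(1) surj by (metis imageE)
  obtain b where b: "b \<in> carrier G" "\<phi> b = \<beta>" using gen_in(2) surj by (metis imageE)
  have "\<phi> ` generate G {a, b} = generate ?H {\<alpha>, \<beta>}"
    using \<phi>.generate_img[of "{a, b}"] a b by simp
  also have "\<dots> = \<phi> ` carrier G"
    unfolding surj using H.generate_consistent[OF _ sub] gen_in by simp
  finally have gen: "generate G {a, b} = carrier G"
    using inj_on_image_eq_iff[OF inj] G.generate_incl[of "{a, b}"] a(1) b(1) by auto
  have in_H: "\<phi> g \<in> carrier H" if "g \<in> carrier G" for g
    using that surj subgroup.subset[OF sub] by blast
  have "shift_cyc3_group G a b k (\<lambda>j g. \<phi> g j)"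
  proof (intro shift_cyc3_group.intro shift_cyc3_group_axioms.intro G)
    show "\<phi> g j permutes ?S j" if "g \<in> carrier G" for g j
      using in_H[OF that] by (simp add: H_def)
    show "\<phi> (g \<otimes>\<^bsub>G\<^esub> h) j = \<phi> g j \<circ> \<phi> h j" if "g \<in> carrier G" "h \<in> carrier G" for g h j
      using \<phi>.hom_mult[OF that] by (simp add: H_def)
    show "g = \<one>\<^bsub>G\<^esub>" if g: "g \<in> carrier G" and triv: "\<And>j. \<phi> g j = id" for g
    proof -
      have "\<phi> g = \<phi> \<one>\<^bsub>G\<^esub>" using triv \<phi>.hom_one by (auto simp: H_def fun_eq_iff)
      then show ?thesis by (rule inj_onD[OF inj _ g G.one_closed])
    qed
  qed (use assms a b gen in \<open>simp_all add: \<alpha>_def \<beta>_def\<close>)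
  then show ?thesis by blast
qed

section \<open>Choice of the degrees\<close>

lemma two_power_le_fact: "4 \<le> m \<Longrightarrow> (2::nat) ^ m \<le> fact m"
proof (induction m rule: nat_induct_at_least)
  case base
  show ?case by (simp add: fact_numeral)
next
  case (Suc m)
  have "2 * 2 ^ m \<le> Suc m * fact m" using Suc by (intro mult_mono) auto
  then show ?case by simp
qed

text \<open>The quotient of \<open>(2 * m)!\<close> by the square of \<open>m!\<close> is a binomial
  coefficient, at most \<open>2 ^ (2 * m)\<close>, and \<open>2 ^ m \<le> m!\<close>.\<close>

lemma fact_double_le:
  assumes "4 \<le> m"
  shows "fact (2 * m) \<le> (fact m :: nat) ^ 4"
proof -
  have "fact (2 * m) = fact m * fact (2 * m - m) * (2 * m choose m)"
    using binomial_fact_lemma[of m "2 * m"] by simp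
  also have "\<dots> \<le> fact m * fact m * 2 ^ (2 * m)"
    using binomial_le_pow2[of "2 * m" m] by simp
  also have "\<dots> = (fact m * fact m) * (2 ^ m * 2 ^ m)"
    by (simp add: mult_2 power_add)
  also have "\<dots> \<le> (fact m * fact m) * (fact m * fact m)"
    using two_power_le_fact[OF assms] by (intro mult_mono) auto
  also have "\<dots> = fact m ^ 4" by (simp add: numeral_eq_Suc)
  finally show ?thesis .
qed

text \<open>Each application of \<open>step\<close> multiplies the exponent by \<open>C1 > 1\<close>
  and the argument by a constant, so finitely many applications reach any exponent
  \<open>p\<close>.\<close>

lemma power_bound_iterate:
  fixes F :: "nat \<Rightarrow> nat" and C1 C2 :: real
  assumes pos: "\<And>n. 1 \<le> n \<Longrightarrow> 1 \<le> F n" and mono: "mono_on {1..} F"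
    and C: "1 < C1" "1 < C2"
    and step: "\<And>n. 1 \<le> n \<Longrightarrow> real (F n) powr C1 \<le> real (at_real F (C2 * real n))"
  shows "\<exists>B\<ge>1. \<forall>n\<ge>1. F n ^ p \<le> F (B * n)"
proof -
  define B where "B = nat \<lceil>C2\<rceil>"
  have B1: "1 \<le> B" using C(2) unfolding B_def by linarith
  have one: "real (F n) powr C1 \<le> real (F (B * n))" if n: "1 \<le> n" for n
  proof -
    have "C2 \<le> real B" unfolding B_def by (rule real_nat_ceiling_ge)
    then have "C2 * real n \<le> real (B * n)" using n by simp
    then have "nat \<lceil>C2 * real n\<rceil> \<le> B * n" by linarith
    moreover have "0 < C2 * real n" using C(2) n by simp
    then have "1 \<le> nat \<lceil>C2 * real n\<rceil>" by linarith
    ultimately have "at_real F (C2 * real n) \<le> F (B * n)"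
      unfolding at_real_def using mono_onD[OF mono] by simp
    then show ?thesis using step[OF n] by linarith
  qed
  have iter: "real (F n) powr (C1 ^ m) \<le> real (F (B ^ m * n))" if n: "1 \<le> n" for n m
  proof (induction m)
    case 0
    then show ?case using pos[OF n] by simp
  next
    case (Suc m)
    have "real (F n) powr (C1 ^ Suc m) = (real (F n) powr (C1 ^ m)) powr C1"
      by (simp add: powr_powr mult.commute)
    also have "\<dots> \<le> real (F (B ^ m * n)) powr C1"
      using Suc C(1) by (intro powr_mono2) auto
    also have "\<dots> \<le> real (F (B * (B ^ m * n)))"
      using n B1 by (intro one) simp
    finally show ?case by (simp add: mult.assoc)
  qed
  obtain m where m: "real p < C1 ^ m" using real_arch_pow[OF C(1)] by blast
  have "F n ^ p \<le> F (B ^ m * n)" if n: "1 \<le> n" for n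
  proof -
    have "real (F n) ^ p = real (F n) powr real p"
      using pos[OF n] by (simp add: powr_realpow)
    also have "\<dots> \<le> real (F n) powr (C1 ^ m)"
      using m pos[OF n] by (intro powr_mono) auto
    also have "\<dots> \<le> real (F (B ^ m * n))" by (rule iter[OF n])
    finally show ?thesis by (metis of_nat_le_iff of_nat_power)
  qed
  then show ?thesis using B1 by (intro exI[of _ "B ^ m"]) simp
qed

text \<open>By \<open>m! \<le> m ^ m\<close> the logarithm of the factorial is at most
  \<open>16 * n * ln (16 * n)\<close>, which the exponent in \<open>lower\<close> at
  \<open>A * n\<close> dominates. The factor 16 is that of the smallest admissible degree
  \<open>2 ^ (j + 4)\<close> over \<open>2 ^ j\<close>.\<close>

lemma factorial_bound:
  fixes F :: "nat \<Rightarrow> nat" and c \<epsilon> :: real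
  assumes "0 < c" "0 < \<epsilon>"
    and lower: "\<And>n. 1 \<le> n \<Longrightarrow>
      exp (c * real n * (ln (real n))\<^sup>2 * loglog_power \<epsilon> n) \<le> real (F n)"
  shows "\<exists>A\<ge>1. \<forall>n\<ge>1. fact (16 * n) \<le> F (A * n)"
proof -
  \<comment> \<open>The first summand makes \<open>c * A\<close> at least 16. The second exceeds
    both 16 and \<open>exp 3\<close>, so \<open>A * n\<close> is at least \<open>16 * n\<close>, its
    logarithm at least 3 and its double logarithm at least 1.\<close>
  define A where "A = nat \<lceil>16 / c\<rceil> + 27"
  have A27: "27 \<le> A" unfolding A_def by simp
  have "16 / c \<le> real A" unfolding A_def by linarith
  then have cA: "16 \<le> c * real A" using assms(1) by (simp add: field_simps)
  have "fact (16 * n) \<le> F (A * n)" if n: "1 \<le> n" for n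
  proof -
    let ?x = "real (A * n)"
    have "A * 1 \<le> A * n" using n by (intro mult_le_mono2)
    then have An: "27 \<le> A * n" using A27 by linarith
    then have x27: "27 \<le> ?x" by linarith
    have "exp (3::real) = exp 1 ^ 3" by (simp flip: exp_of_nat_mult)
    also have "\<dots> \<le> 3 ^ 3" by (intro power_mono exp_le) simp
    finally have "exp (3::real) \<le> ?x" using x27 by simp
    then have ln3: "3 \<le> ln ?x" using x27 by (simp add: ln_ge_iff)
    then have "exp 1 \<le> ln ?x" using exp_le by linarith
    then have "1 \<le> ln (ln ?x)" using ln3 by (simp add: ln_ge_iff)
    then have llp: "1 \<le> loglog_power \<epsilon> (A * n)"
      unfolding loglog_power_def using An assms(2) by (simp add: ge_one_powr_ge_zero)
    have "ln (real (16 * n)) \<le> ln ?x" using A27 n by simp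
    also have "\<dots> \<le> (ln ?x)\<^sup>2" using ln3 by (simp add: power2_eq_square)
    finally have lnle: "ln (real (16 * n)) \<le> (ln ?x)\<^sup>2" .
    have "real (16 * n) * ln (real (16 * n)) \<le> (c * ?x) * (ln ?x)\<^sup>2"
    proof (rule mult_mono)
      show "real (16 * n) \<le> c * ?x" using mult_right_mono[OF cA, of "real n"] by simp
    qed (use lnle n assms(1) in auto)
    also have "\<dots> \<le> c * ?x * (ln ?x)\<^sup>2 * loglog_power \<epsilon> (A * n)"
      using mult_left_mono[OF llp, of "c * ?x * (ln ?x)\<^sup>2"] assms(1) by simp
    finally have ex: "real (16 * n) * ln (real (16 * n)) \<le> c * ?x * (ln ?x)\<^sup>2 * loglog_power \<epsilon> (A * n)" .
    have "real (fact (16 * n)) \<le> real (16 * n) ^ (16 * n)"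
      using fact_le_power[of "16 * n", where 'a = real] by simp
    also have "\<dots> = exp (real (16 * n) * ln (real (16 * n)))"
      using n by (subst exp_of_nat_mult) simp
    also have "\<dots> \<le> exp (c * ?x * (ln ?x)\<^sup>2 * loglog_power \<epsilon> (A * n))" using ex by simp
    also have "\<dots> \<le> real (F (A * n))" by (rule lower) (use An in linarith)
    finally show ?thesis by (simp only: of_nat_le_iff)
  qed
  then show ?thesis using A27 by (intro exI[of _ A]) auto
qed

text \<open>Restricting degrees to powers of two costs only a bounded power of the factorial, which
  hypothesis (b) absorbs.\<close>

lemma exponent_exists:
  fixes F :: "nat \<Rightarrow> nat"
  assumes pos: "\<And>n. 1 \<le> n \<Longrightarrow> 1 \<le> F n" and mono: "mono_on {1..} F"
    and A: "\<And>n. 1 \<le> n \<Longrightarrow> fact (16 * n) \<le> F (A * n)" "\<And>n. 1 \<le> n \<Longrightarrow> F n ^ 8 \<le> F (A * n)"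
  shows "\<exists>k. j + 4 \<le> k \<and> 2 * F (2 ^ j) \<le> fact (2 ^ k) \<and> fact (2 ^ k) \<le> F (A * 2 ^ j)"
proof -
  let ?f = "F (2 ^ j)"
  let ?P = "\<lambda>k. j + 4 \<le> k \<and> 2 * ?f \<le> fact (2 ^ k)"
  \<comment> \<open>If the least admissible exponent is \<open>j + 4\<close>, the bound on
    \<open>fact (16 * n)\<close> applies. Otherwise minimality keeps the factorial of half the
    degree below \<open>2 * ?f\<close>, and doubling the degree costs at most a fourth
    power.\<close>
  define k where "k = (LEAST k. ?P k)"
  have "?P (j + 4 + 2 * ?f)"
  proof -
    have "2 * ?f \<le> j + 4 + 2 * ?f" by simp
    also have "\<dots> \<le> 2 ^ (j + 4 + 2 * ?f)" by (rule less_imp_le[OF less_exp])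
    also have "\<dots> \<le> fact (2 ^ (j + 4 + 2 * ?f))" by (rule fact_ge_self)
    finally show ?thesis by simp
  qed
  then have k: "?P k" unfolding k_def by (rule LeastI)
  have "fact (2 ^ k) \<le> F (A * 2 ^ j)"
  proof (cases "k = j + 4")
    case True
    then show ?thesis using A(1)[of "2 ^ j"] by (simp add: power_add mult.commute)
  next
    case False
    then obtain k' where k': "k = Suc k'" "j + 4 \<le> k'" using k by (cases k) auto
    have "\<not> ?P k'" using k' not_less_Least[of k' ?P] unfolding k_def by (metis lessI)
    then have less: "fact (2 ^ k') < 2 * ?f" using k' by simp
    have "(2::nat) ^ 4 \<le> 2 ^ k'" using k' by (intro power_increasing) auto
    then have k16: "16 \<le> (2::nat) ^ k'" by simp
    then have "16 \<le> (fact (2 ^ k') :: nat)" using fact_ge_self[of "2 ^ k'"] by linarith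
    \<comment> \<open>This lets \<open>?f\<close> absorb the factor 2: the fourth power of
      \<open>2 * ?f\<close> is at most \<open>?f ^ 8\<close>, which explains the exponent 8.\<close>
    then have f2: "2 \<le> ?f" using less by linarith
    have "fact (2 ^ k) = (fact (2 * 2 ^ k') :: nat)" unfolding k' by simp
    also have "\<dots> \<le> fact (2 ^ k') ^ 4" using k16 by (intro fact_double_le) simp
    also have "\<dots> \<le> (2 * ?f) ^ 4" using less by (intro power_mono) auto
    also have "\<dots> \<le> (?f * ?f) ^ 4" using f2 by (intro power_mono mult_right_mono) auto
    also have "\<dots> = ?f ^ 8" by (simp flip: power_add power_mult power2_eq_square)
    also have "\<dots> \<le> F (A * 2 ^ j)" by (rule A(2)) simp
    finally show ?thesis .
  qed
  then show ?thesis using k by blast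
qed

theorem theorem1p1:
  fixes F :: "nat \<Rightarrow> nat"
  assumes "F \<in> {1..} \<rightarrow> {1..}"
    and "mono_on {1..} F"
    and "\<exists>c \<epsilon> :: real. c > 0 \<and> \<epsilon> > 0 \<and>
           (\<forall>n\<ge>1. real (F n) \<ge> exp (c * real n * (ln (real n))\<^sup>2 * loglog_power \<epsilon> n))"
    and "\<exists>C1 C2 :: real. C1 > 1 \<and> C2 > 1 \<and>
           (\<forall>n\<ge>1. real (F n) powr C1 \<le> real (at_real F (C2 * real n)))"
  shows "\<exists>(G :: nat monoid) S. group G \<and> residually_finite G \<and>
           finite S \<and> S \<subseteq> carrier G \<and> generate G S = carrier G \<and>
           (\<exists>C1' C2' :: real. C1' > 0 \<and> C2' > 0 \<and>
              (\<forall>n\<ge>1. at_real F (C1' * real n) \<le> rf_growth G S n \<and>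
                      rf_growth G S n \<le> at_real F (C2' * real n)))"
proof -
  have pos: "1 \<le> F n" if "1 \<le> n" for n using assms(1) that by auto
  obtain c \<epsilon> :: real where "0 < c" "0 < \<epsilon>"
    "\<And>n. 1 \<le> n \<Longrightarrow> exp (c * real n * (ln (real n))\<^sup>2 * loglog_power \<epsilon> n) \<le> real (F n)"
    using assms(3) by blast
  from factorial_bound[OF this]
  obtain A1 where A1: "1 \<le> A1" "\<And>n. 1 \<le> n \<Longrightarrow> fact (16 * n) \<le> F (A1 * n)" by blast
  obtain C1 C2 :: real where "1 < C1" "1 < C2"
    "\<And>n. 1 \<le> n \<Longrightarrow> real (F n) powr C1 \<le> real (at_real F (C2 * real n))"
    using assms(4) by blast
  from power_bound_iterate[OF pos assms(2) this, of 8]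
  obtain A2 where A2: "1 \<le> A2" "\<And>n. 1 \<le> n \<Longrightarrow> F n ^ 8 \<le> F (A2 * n)" by blast
  \<comment> \<open>Since \<open>F\<close> is nondecreasing, both bounds hold with the larger
    constant.\<close>
  define A where "A = max A1 A2"
  have A: "1 \<le> A" using A1(1) unfolding A_def by simp
  have le: "F (A1 * n) \<le> F (A * n)" "F (A2 * n) \<le> F (A * n)" if "1 \<le> n" for n
    using that A1(1) A2(1) A by (auto simp: A_def intro!: mono_onD[OF assms(2)])
  have "\<exists>k. j + 4 \<le> k \<and> 2 * F (2 ^ j) \<le> fact (2 ^ k) \<and> fact (2 ^ k) \<le> F (A * 2 ^ j)" for j
    by (rule exponent_exists[OF pos assms(2) order_trans[OF A1(2) le(1)] order_trans[OF A2(2) le(2)]])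
  then obtain k where k: "\<And>j. j + 4 \<le> k j" "\<And>j. 2 * F (2 ^ j) \<le> fact (2 ^ k j)"
    "\<And>j. fact (2 ^ k j) \<le> F (A * 2 ^ j)" by metis
  obtain G :: "nat monoid" and a b \<pi> where "shift_cyc3_group G a b k \<pi>"
    using shift_cyc3_group_exists[OF k(1)] by blast
  then interpret shift_cyc3_group G a b k \<pi> .
  \<comment> \<open>Without the generator \<open>witness 0\<close>, the depths in the unit ball are at most 3, which can be less
    than \<open>F 1\<close>.\<close>
  let ?S = "{a, b, witness 0}"
  have S: "?S \<subseteq> carrier G" by simp
  have "generate G {a, b} \<subseteq> generate G ?S" by (rule mono_generate) auto
  then have "generate G ?S = carrier G"
    using generators generate_incl[OF S] by blast
  moreover have "\<exists>C1' C2' :: real. C1' > 0 \<and> C2' > 0 \<and>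
      (\<forall>n\<ge>1. at_real F (C1' * real n) \<le> rf_growth G ?S n \<and>
             rf_growth G ?S n \<le> at_real F (C2' * real n))"
    using rf_growth_bounds[OF assms(2) A _ k(2,3)] A
    by (intro exI[of _ "1 / 24"] exI[of _ "real (24 * A)"]) simp
  ultimately show ?thesis
    using is_group residually_finite_G S
    by (intro exI[of _ G] exI[of _ ?S]) simp
qed

end
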